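(* Let $\nu\in\mathbb{N}$ and let $f(\lambda)=c\,|\lambda|^{-2\alpha}(1+\lambda^2)^{-\beta}$, $\lambda\in\mathbb{R}$, with $0<c<\infty$ (the spectral density of a fractional Riesz–Bessel motion), and let $g$ be an integrable real even function on $\mathbb{R}$. Suppose that for some $p,q\ge1$ with $1/p+1/q\le 1/\nu$ we have $g\in L^q(\mathbb{R})$, $0<\alpha<1/(2p)$ and $\alpha+\beta>1/2$, $\beta>0$. Then $$\Delta_{\nu,W}(T):=\left|\frac1T\,\mathrm{tr}\big[W_T(f)W_T(g)\big]^\nu-(2\pi)^{2\nu-1}\int_{-\infty}^{\infty}[f(\lambda)g(\lambda)]^\nu\,d\lambda\right|=o(1)\quad\text{as }T\to\infty.$$
   Context: For an integrable real even function $h$ on $\mathbb{R}$, $\hat h(t)=\int_{\mathbb{R}}e^{i\lambda t}h(\lambda)\,d\lambda$, and for $T>0$ the $T$-truncated Toeplitz operator $W_T(h)$ on $L^2[0,T]$ is $[W_T(h)u](t)=\int_0^T\hat h(t-s)u(s)\,ds$; $\mathrm{tr}$ is the operator trace. *)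

theory Defs
  imports "HOL-Analysis.Analysis"
begin

definition fourier_hat :: "(real \<Rightarrow> real) \<Rightarrow> real \<Rightarrow> complex" where
  "fourier_hat h t = (\<integral>l. exp (\<i> * complex_of_real (l * t)) * complex_of_real (h l) \<partial>lborel)"

definition toeplitz_op :: "real \<Rightarrow> (real \<Rightarrow> real) \<Rightarrow> (real \<Rightarrow> complex) \<Rightarrow> (real \<Rightarrow> complex)" where
  "toeplitz_op T h u = (\<lambda>t. LINT s:{0..T}|lborel. fourier_hat h (t - s) * u s)"

definition fourier_basis :: "real \<Rightarrow> int \<Rightarrow> real \<Rightarrow> complex" where
  "fourier_basis T n t = exp (2 * complex_of_real pi * \<i> * of_int n * complex_of_real (t / T)) / complex_of_real (sqrt T)"

text \<open>Operator trace on L2[0,T], computed in the orthonormal basis above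
  (basis independent for trace class operators).\<close>
definition op_trace :: "real \<Rightarrow> ((real \<Rightarrow> complex) \<Rightarrow> (real \<Rightarrow> complex)) \<Rightarrow> complex" where
  "op_trace T A = (\<Sum>\<^sub>\<infinity>n\<in>(UNIV::int set).
      LINT t:{0..T}|lborel. A (fourier_basis T n) t * cnj (fourier_basis T n t))"

definition frbm_density :: "real \<Rightarrow> real \<Rightarrow> real \<Rightarrow> real \<Rightarrow> real" where
  "frbm_density c \<alpha> \<beta> l = c * \<bar>l\<bar> powr (-2 * \<alpha>) * (1 + l\<^sup>2) powr (-\<beta>)"

end

theory Submission
  imports Defs "HOL-Probability.Sinc_Integral"
begin

text \<open>Writing each kernel of the product as a Fourier integral turns the trace into the cyclic
  form, the integral of \<open>h\<^sub>1(x\<^sub>1) \<cdots> h\<^sub>m(x\<^sub>m) S(x\<^sub>1 - x\<^sub>2) \<cdots> S(x\<^sub>m - x\<^sub>1)\<close> with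
  \<open>S(u) = 2 sin(uT/2)/u\<close> and with \<open>h\<^sub>i\<close> alternately \<open>f\<close> and \<open>g\<close>.
  Convolution with \<open>S\<close> is \<open>2\<pi>\<close> times an orthogonal projection, so for symbols bounded by
  \<open>b\<^sub>i\<close> the form is at most \<open>T (2\<pi>)\<^sup>m\<^sup>-\<^sup>1\<close> times the \<open>L\<^sup>1\<close> norm of one symbol and the
  bounds of the others. Replacing \<open>h\<^sub>1, h\<^sub>2\<close> by the single symbol \<open>2\<pi> h\<^sub>1 h\<^sub>2\<close> costs \<open>o(T)\<close>, because the commutator of
  \<open>S\<close> with multiplication by \<open>h\<^sub>2\<close> is governed by the modulus of continuity of \<open>h\<^sub>2\<close>; this gives
  the limit for bounded symbols. For unbounded symbols, give each \<open>h\<^sub>i\<close> an exponent \<open>r\<^sub>i\<close> with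
  \<open>\<Sum> 1/r\<^sub>i = 1\<close> and truncate all of them simultaneously to the sets where the \<open>r\<^sub>i\<close>-th power of
  \<open>\<bar>h\<^sub>i\<bar>\<close> is at most \<open>2\<^sup>k\<close>: the
  bound above makes the change from level \<open>k\<close> to \<open>k + 1\<close> at most \<open>O(T)\<close> times the part of the
  \<open>r\<^sub>i\<close>-th moments lying between the two levels, so the truncation error divided by \<open>T\<close>
  tends to \<open>0\<close> as \<open>k\<close> grows, uniformly in \<open>T\<close>.\<close>

section \<open>A Parseval identity for the cardinal sine\<close>

text \<open>The trace is a sum of diagonal coefficients over the Fourier basis, so it appears as a
  sum of kernel values over the lattice \<open>2 * pi / T * of_int n\<close> rather than as an
  integral. A discrete Parseval identity for the cardinal sine converts one into the other. Averaged
  over shifts of the lattice, the same identity gives the projection property of S, so both facts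
  rest on the series for the digamma and trigamma functions. S decays only like 1/u and is not
  absolutely integrable; exchanges of integrals therefore lean on Cauchy-Schwarz or on the
  boundedness of S against integrable symbols.

  For unbounded symbols one would expect a Hoelder inequality between Schatten norms. The bound with
  a single L^1 norm replaces it: the truncated symbols are bounded by 2^(k/r_i), these bounds
  multiply to 2^k, and between two consecutive levels 2^k is comparable to the r_i-th power of the
  symbol. Each change of level is thus paid for by the moments of its own shell, and the costs
  telescope. Reciprocals summing exactly to 1 are obtained by multiplying p and q by the common
  factor \<nu> (1/p + 1/q) \<le> 1.\<close>

lemma has_sum_int_halves:
  fixes F :: "int \<Rightarrow> real"
  assumes "((\<lambda>k::nat. F (int k)) has_sum A) UNIV" "((\<lambda>k::nat. F (- 1 - int k)) has_sum B) UNIV"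
  shows "(F has_sum (A + B)) UNIV"
proof -
  have "bij_betw int UNIV {0::int..}"
    by (rule bij_betw_byWitness[of _ nat]) auto
  from has_sum_reindex_bij_betw[OF this, of F A]
  have 1: "(F has_sum A) {0..}" using assms(1) by simp
  have "bij_betw (\<lambda>k::nat. - 1 - int k) UNIV {..<0::int}"
    by (rule bij_betw_byWitness[of _ "\<lambda>n. nat (- 1 - n)"]) auto
  from has_sum_reindex_bij_betw[OF this, of F B]
  have 2: "(F has_sum B) {..<0}" using assms(2) by simp
  have "{0..} \<union> {..<0} = (UNIV :: int set)" "{0..} \<inter> {..<0::int} = {}" by auto
  with has_sum_Un_disjoint[OF 1 2] show ?thesis by simp
qed

text \<open>Logarithmic differentiation of Euler's reflection formula Gamma(z) Gamma(1 - z) = pi /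
  sin(pi z): both sides are differentiated and the nonzero common factor is cancelled.\<close>

lemma Digamma_reflection_complex:
  fixes z :: complex
  assumes z: "z \<notin> \<int>"
  shows "Digamma (1 - z) - Digamma z = of_real pi * cot (of_real pi * z)"
proof -
  have z1: "1 - z \<notin> \<int>" using z by (metis Ints_1 Ints_diff diff_diff_eq2 add_diff_cancel_left')
  have s: "sin (of_real pi * z) \<noteq> 0"
  proof
    assume "sin (of_real pi * z) = 0"
    then obtain n :: int where "of_real pi * z = of_real (real_of_int n * pi)"
      by (auto simp: sin_eq_0)
    then have "z = of_int n" by (simp add: field_simps)
    with z show False by simp
  qed
  have np: "z \<notin> \<int>\<^sub>\<le>\<^sub>0" "1 - z \<notin> \<int>\<^sub>\<le>\<^sub>0" using z z1 nonpos_Ints_Int by auto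
  have d1: "((\<lambda>z::complex. Gamma z * Gamma (1 - z)) has_field_derivative
     (Gamma z * Gamma (1 - z) * (Digamma z - Digamma (1 - z)))) (at z)"
    using np by (auto intro!: derivative_eq_intros simp: algebra_simps)
  have d2: "((\<lambda>z::complex. of_real pi / sin (of_real pi * z)) has_field_derivative
     (- ((of_real pi)\<^sup>2) * cos (of_real pi * z) / (sin (of_real pi * z))\<^sup>2)) (at z)"
    using s by (auto intro!: derivative_eq_intros simp: power2_eq_square field_simps)
  have "Gamma z * Gamma (1 - z) * (Digamma z - Digamma (1 - z)) =
     - ((of_real pi)\<^sup>2) * cos (of_real pi * z) / (sin (of_real pi * z))\<^sup>2"
    using DERIV_unique[OF d1] d2 unfolding Gamma_reflection_complex by blast
  then have "(of_real pi / sin (of_real pi * z)) * (Digamma z - Digamma (1 - z)) =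
     (of_real pi / sin (of_real pi * z)) * (- of_real pi * cot (of_real pi * z))"
    unfolding Gamma_reflection_complex cot_def by (simp add: power2_eq_square)
  then have "Digamma z - Digamma (1 - z) = - of_real pi * cot (of_real pi * z)"
    using s by (subst (asm) mult_cancel_left) auto
  then show ?thesis by (simp add: algebra_simps)
qed

lemma Digamma_reflection_real:
  fixes x :: real
  assumes x: "x \<notin> \<int>"
  shows "Digamma (1 - x) - Digamma x = pi * cot (pi * x)"
proof -
  have "complex_of_real x \<notin> \<int>" using x by simp
  from Digamma_reflection_complex[OF this]
  have "complex_of_real (Digamma (1 - x) - Digamma x) = complex_of_real (pi * cot (pi * x))"
    using x by (subst (asm) of_real_1[symmetric], subst (asm) of_real_diff[symmetric],
      subst (asm) (1 2) Polygamma_of_real) (auto simp: cot_of_real)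
  then show ?thesis using of_real_eq_iff by blast
qed

lemma sin_pi_nonzero: "x \<notin> \<int> \<Longrightarrow> sin (pi * x) \<noteq> (0::real)"
proof
  assume x: "x \<notin> \<int>" and "sin (pi * x) = 0"
  then obtain i::int where "pi * x = of_int i * pi" by (auto simp: sin_zero_iff_int2)
  then have "x = of_int i" by simp
  with x show False by simp
qed

text \<open>Derivative of the digamma reflection formula. That formula holds on the whole open set
  of non-integers, so the derivatives of its two sides agree at \<open>x\<close>.\<close>

lemma Trigamma_reflection_real:
  fixes x :: real
  assumes x: "x \<notin> \<int>"
  shows "Polygamma 1 (1 - x) + Polygamma 1 x = pi\<^sup>2 / (sin (pi * x))\<^sup>2"
proof -
  have x1: "1 - x \<notin> \<int>" using x by (metis Ints_1 Ints_diff diff_diff_eq2 add_diff_cancel_left')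
  have np: "x \<notin> \<int>\<^sub>\<le>\<^sub>0" "1 - x \<notin> \<int>\<^sub>\<le>\<^sub>0" using x x1 nonpos_Ints_Int by auto
  note s = sin_pi_nonzero[OF x]
  have d1: "((\<lambda>x::real. Digamma (1 - x) - Digamma x) has_field_derivative
     (- Polygamma 1 (1 - x) - Polygamma 1 x)) (at x)"
    using np by (auto intro!: derivative_eq_intros)
  have d2: "((\<lambda>x::real. pi * cot (pi * x)) has_field_derivative
     (- (pi\<^sup>2 / (sin (pi * x))\<^sup>2))) (at x)"
    using s by (auto intro!: derivative_eq_intros DERIV_chain2[OF DERIV_cot] simp: power2_eq_square field_simps)
  have o: "open (- \<int> :: real set)" by (simp add: closed_Ints open_Compl)
  have "((\<lambda>x::real. Digamma (1 - x) - Digamma x) has_field_derivative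
     (- (pi\<^sup>2 / (sin (pi * x))\<^sup>2))) (at x)"
    by (rule has_field_derivative_transform_within_open[OF d2 o]) (use x in \<open>auto simp: Digamma_reflection_real\<close>)
  from DERIV_unique[OF d1 this] show ?thesis by simp
qed

text \<open>The indices n >= 0 give the trigamma series at \<open>a\<close>; the indices n = -1 - k
  give the one at \<open>1 - a\<close>, since the square hides the sign. Reflection adds the two
  values.\<close>

lemma has_sum_inverse_square_int:
  fixes a :: real
  assumes a: "a \<notin> \<int>"
  shows "((\<lambda>n::int. 1 / (a + of_int n)\<^sup>2) has_sum (pi\<^sup>2 / (sin (pi * a))\<^sup>2)) UNIV"
proof -
  have a1: "1 - a \<notin> \<int>" using a by (metis Ints_1 Ints_diff diff_diff_eq2 add_diff_cancel_left')
  then have nz: "a \<noteq> 0" "1 - a \<noteq> 0" using a by auto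
  have *: "((\<lambda>k. 1 / (z + real k)\<^sup>2) has_sum Polygamma 1 z) UNIV" if "z \<noteq> 0" for z :: real
    using Polygamma_LIMSEQ[OF that, of 1] 
    by (intro sums_nonneg_imp_has_sum) (auto simp: numeral_2_eq_2 inverse_eq_divide)
  have "((\<lambda>n::int. 1 / (a + of_int n)\<^sup>2) has_sum (Polygamma 1 a + Polygamma 1 (1 - a))) UNIV"
  proof (rule has_sum_int_halves)
    show "((\<lambda>k. 1 / (a + real_of_int (int k))\<^sup>2) has_sum Polygamma 1 a) UNIV"
      using *[OF nz(1)] by simp
    have "(a + real_of_int (- 1 - int k))\<^sup>2 = (1 - a + real k)\<^sup>2" for k
      by (simp add: power2_eq_square algebra_simps)
    then show "((\<lambda>k. 1 / (a + real_of_int (- 1 - int k))\<^sup>2) has_sum Polygamma 1 (1 - a)) UNIV"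
      using *[OF nz(2)] by simp
  qed
  with Trigamma_reflection_real[OF a] show ?thesis by (simp add: add.commute)
qed

text \<open>Partial fractions turn the series into a difference of two divergent harmonic-type
  series, whose regularized limits are digamma values. Absolute convergence comes from uv \<le> u^2
  + v^2.\<close>

lemma has_sum_inverse_product_nat:
  fixes a b :: real
  assumes "a \<noteq> b" and a: "\<And>k. a + real k \<noteq> 0" and b: "\<And>k. b + real k \<noteq> 0"
  shows "((\<lambda>k. 1 / ((a + real k) * (b + real k))) has_sum ((Digamma b - Digamma a) / (b - a))) UNIV"
proof (rule norm_summable_imp_has_sum)
  have nz: "a \<noteq> 0" "b \<noteq> 0" using a[of 0] b[of 0] by auto
  have s: "summable (\<lambda>k. inverse ((a + real k)\<^sup>2) + inverse ((b + real k)\<^sup>2))"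
    using Polygamma_converges'[OF nz(1), of 2] Polygamma_converges'[OF nz(2), of 2]
    by (intro summable_add) auto
  show "summable (\<lambda>k. norm (1 / ((a + real k) * (b + real k))))"
  proof (rule summable_comparison_test'[OF s, of 0])
    fix n :: nat
    define u v where "u = inverse \<bar>a + real n\<bar>" and "v = inverse \<bar>b + real n\<bar>"
    have "0 \<le> (u - v)\<^sup>2" "0 \<le> u * v" unfolding u_def v_def by auto
    then have "u * v \<le> u\<^sup>2 + v\<^sup>2" by (simp add: power2_eq_square algebra_simps)
    then show "norm (norm (1 / ((a + real n) * (b + real n)))) \<le> inverse ((a + real n)\<^sup>2) + inverse ((b + real n)\<^sup>2)"
      unfolding u_def v_def by (simp add: abs_mult inverse_eq_divide power_divide)
  qed
  \<comment> \<open>The logarithms cancel; they are inserted so that each bracket converges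
    separately to a digamma value.\<close>
  have "(\<lambda>m. ((ln (real m) - (\<Sum>n<m. inverse (b + real n))) - (ln (real m) - (\<Sum>n<m. inverse (a + real n)))) / (b - a))
     \<longlonglongrightarrow> (Digamma b - Digamma a) / (b - a)"
    by (intro tendsto_divide tendsto_diff tendsto_const) 
      (use Digamma_LIMSEQ[OF nz(1)] Digamma_LIMSEQ[OF nz(2)] assms in auto)
  moreover have "((ln (real m) - (\<Sum>n<m. inverse (b + real n))) - (ln (real m) - (\<Sum>n<m. inverse (a + real n)))) / (b - a)
     = (\<Sum>k<m. 1 / ((a + real k) * (b + real k)))" for m
  proof -
    have "1 / ((a + real k) * (b + real k)) = (inverse (a + real k) - inverse (b + real k)) / (b - a)" for k
      using a[of k] b[of k] assms(1) by (simp add: divide_simps)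
    then show ?thesis by (simp add: sum_subtractf flip: sum_divide_distrib)
  qed
  ultimately show "(\<lambda>k. 1 / ((a + real k) * (b + real k))) sums ((Digamma b - Digamma a) / (b - a))"
    unfolding sums_def by simp
qed

text \<open>The two half-line sums regroup into the digamma reflection at \<open>a\<close> minus
  that at \<open>b\<close>, which leaves only cotangents.\<close>

lemma has_sum_inverse_product_int:
  fixes a b :: real
  assumes a: "a \<notin> \<int>" and b: "b \<notin> \<int>" and ab: "a \<noteq> b"
  shows "((\<lambda>n::int. 1 / ((a + of_int n) * (b + of_int n))) has_sum
    ((pi * cot (pi * a) - pi * cot (pi * b)) / (b - a))) UNIV"
proof -
  have ni: "z + real k \<noteq> 0" "1 - z + real k \<noteq> 0" if "z \<notin> \<int>" for z k
  proof -
    have "z \<noteq> - real k" "z \<noteq> 1 + real k" using that by auto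
    then show "z + real k \<noteq> 0" "1 - z + real k \<noteq> 0" by auto
  qed
  have "((\<lambda>n::int. 1 / ((a + of_int n) * (b + of_int n))) has_sum
     ((Digamma b - Digamma a) / (b - a) + (Digamma (1 - b) - Digamma (1 - a)) / ((1 - b) - (1 - a)))) UNIV"
  proof (rule has_sum_int_halves)
    show "((\<lambda>k. 1 / ((a + real_of_int (int k)) * (b + real_of_int (int k)))) has_sum (Digamma b - Digamma a) / (b - a)) UNIV"
      using has_sum_inverse_product_nat[OF ab] ni a b by simp
    have e: "(a + real_of_int (- 1 - int k)) * (b + real_of_int (- 1 - int k)) = (1 - a + real k) * (1 - b + real k)" for k
      by (simp add: algebra_simps)
    show "((\<lambda>k. 1 / ((a + real_of_int (- 1 - int k)) * (b + real_of_int (- 1 - int k)))) has_sum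
       (Digamma (1 - b) - Digamma (1 - a)) / ((1 - b) - (1 - a))) UNIV"
      unfolding e using has_sum_inverse_product_nat[of "1 - a" "1 - b"] ni a b ab by simp
  qed
  moreover have "(Digamma b - Digamma a) / (b - a) + (Digamma (1 - b) - Digamma (1 - a)) / ((1 - b) - (1 - a))
    = ((Digamma (1 - a) - Digamma a) - (Digamma (1 - b) - Digamma b)) / (b - a)"
    using ab by (simp add: divide_simps) (simp add: algebra_simps)
  ultimately show ?thesis by (simp add: Digamma_reflection_real a b)
qed

section \<open>The normalized cardinal sine and its discrete Parseval identity\<close>

definition nsinc :: "real \<Rightarrow> real" where
  "nsinc a = (if a = 0 then 1 else sin (pi * a) / (pi * a))"

lemma nsinc_minus [simp]: "nsinc (- a) = nsinc a"
  by (simp add: nsinc_def)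

lemma nsinc_of_int: "nsinc (of_int n) = (if n = 0 then 1 else 0)"
  by (simp add: nsinc_def sin_zero_iff_int2)

lemma abs_nsinc_le_1: "\<bar>nsinc a\<bar> \<le> 1"
  using abs_sin_x_le_abs_x[of "pi * a"] by (auto simp: nsinc_def field_simps)

text \<open>The alternating sign disappears in a product of two such values with the same
  \<open>n\<close>, so the Parseval sum becomes a series of rational functions.\<close>

lemma nsinc_add_of_int:
  assumes "a \<notin> \<int>"
  shows "nsinc (a + of_int n) = (if even n then 1 else - 1) * sin (pi * a) / (pi * (a + of_int n))"
proof -
  have "a + of_int n \<noteq> 0" using assms by (metis Ints_minus Ints_of_int add.commute eq_neg_iff_add_eq_0 minus_minus)
  moreover have "cos (pi * of_int n) = (if even n then 1 else - 1)"
    by (rule cos_npi_int)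
  moreover have "sin (pi * of_int n) = 0" by (rule sin_npi_int)
  ultimately show ?thesis unfolding nsinc_def
    by (simp add: ring_distribs sin_add)
qed

lemma nsinc_Parseval_plus:
  "((\<lambda>n::int. nsinc (a + of_int n) * nsinc (b + of_int n)) has_sum nsinc (a - b)) UNIV"
proof -
  have int: "((\<lambda>n::int. nsinc (a + of_int n) * nsinc (b + of_int n)) has_sum nsinc (a - b)) UNIV"
    if "a \<in> \<int>" for a b
  proof -
    obtain m where m: "a = of_int m" using \<open>a \<in> \<int>\<close> by (auto elim: Ints_cases)
    have "((\<lambda>n::int. nsinc (a + of_int n) * nsinc (b + of_int n)) has_sum 
      (\<Sum>n\<in>{-m}. nsinc (a + of_int n) * nsinc (b + of_int n))) UNIV"
    proof (rule has_sum_finite_neutralI)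
      fix n assume "n \<in> UNIV - {- m}"
      then have "nsinc (of_int (m + n)) = 0" unfolding nsinc_of_int by auto
      then show "nsinc (a + of_int n) * nsinc (b + of_int n) = 0" using m by simp
    qed auto
    then show ?thesis using m nsinc_minus[of "a - b"] by (simp add: nsinc_of_int[of 0, simplified])
  qed
  \<comment> \<open>At an integer argument only one term survives, because \<open>nsinc\<close>
    vanishes at nonzero integers. Otherwise the sine factors come out of the sum; equal arguments
    lead to the inverse-square series, distinct ones to cotangents whose difference is sin(pi (b -
    a)) over the product of the sines.\<close>
  consider "a \<in> \<int>" | "b \<in> \<int>" | "a \<notin> \<int>" "b \<notin> \<int>" "a = b" | "a \<notin> \<int>" "b \<notin> \<int>" "a \<noteq> b" by blast
  then show ?thesis
  proof cases
    case 1 then show ?thesis by (rule int)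
  next
    case 2 then show ?thesis using int[of b a] nsinc_minus[of "a - b"] by (simp add: mult.commute)
  next
    case 3
    have "nsinc (a + of_int n) * nsinc (b + of_int n) = (sin (pi * a))\<^sup>2 / pi\<^sup>2 * (1 / (a + of_int n)\<^sup>2)" for n :: int
      using 3 by (simp add: nsinc_add_of_int power2_eq_square)
    moreover have "(sin (pi * a))\<^sup>2 / pi\<^sup>2 * (pi\<^sup>2 / (sin (pi * a))\<^sup>2) = 1"
      using sin_pi_nonzero[OF 3(1)] by simp
    ultimately show ?thesis
      using has_sum_cmult_right[OF has_sum_inverse_square_int[OF 3(1)], of "(sin (pi * a))\<^sup>2 / pi\<^sup>2"] 3(3)
      by (simp add: nsinc_of_int[of 0, simplified])
  next
    case 4
    let ?c = "sin (pi * a) * sin (pi * b) / pi\<^sup>2"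
    have "nsinc (a + of_int n) * nsinc (b + of_int n) = ?c * (1 / ((a + of_int n) * (b + of_int n)))" for n :: int
      using 4 by (simp add: nsinc_add_of_int power2_eq_square)
    moreover have "?c * ((pi * cot (pi * a) - pi * cot (pi * b)) / (b - a)) = nsinc (b - a)"
      using sin_pi_nonzero[OF 4(1)] sin_pi_nonzero[OF 4(2)] 4(3)
      by (simp add: nsinc_def cot_def right_diff_distrib sin_diff field_simps power2_eq_square)
    ultimately show ?thesis
      using has_sum_cmult_right[OF has_sum_inverse_product_int[OF 4], of ?c] nsinc_minus[of "a - b"]
      by simp
  qed
qed

section \<open>The reproducing kernel of the time window\<close>

text \<open>An enumeration of the integers reduces this to termwise integration of an ordinary
  series. Domination is asked for on finite absolute sums, the form in which
  \<open>sker_Bessel\<close> supplies it.\<close>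

lemma has_sum_integral_int:
  fixes F :: "int \<Rightarrow> 'a \<Rightarrow> real"
  assumes [measurable]: "\<And>n. F n \<in> borel_measurable M"
    and s: "\<And>x. ((\<lambda>n. F n x) has_sum G x) UNIV"
    and b: "\<And>x N. finite N \<Longrightarrow> (\<Sum>n\<in>N. \<bar>F n x\<bar>) \<le> B x"
    and B: "integrable M B"
  shows "integrable M G" and "((\<lambda>n. integral\<^sup>L M (F n)) has_sum integral\<^sup>L M G) UNIV"
proof -
  define e where "e = int_decode"
  have e: "bij_betw e UNIV UNIV" unfolding e_def using bij_int_decode by auto
  have int: "integrable M (F n)" for n
    by (rule Bochner_Integration.integrable_bound[OF B]) (use b[of "{n}"] in \<open>auto intro!: AE_I2 intro: order_trans[OF _ abs_ge_self]\<close>)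
  have bd: "(\<Sum>i<m. \<bar>F (e i) x\<bar>) \<le> B x" for m x
    using b[of "e ` {..<m}" x] sum.reindex[OF inj_on_subset[OF bij_betw_imp_inj_on[OF e]], of "{..<m}" "\<lambda>n. \<bar>F n x\<bar>"]
    by simp
  have 1: "summable (\<lambda>i. norm (F (e i) x))" for x
    by (rule summableI_nonneg_bounded[of _ "B x"]) (use bd in auto)
  have "((\<lambda>i. F (e i) x) has_sum G x) UNIV" for x
    using s has_sum_reindex_bij_betw[OF e, of "\<lambda>n. F n x" "G x"] by simp
  then have G: "G x = (\<Sum>i. F (e i) x)" for x
    using has_sum_imp_sums sums_unique by blast
  have 2: "summable (\<lambda>i. \<integral>x. norm (F (e i) x) \<partial>M)"
  proof (rule summableI_nonneg_bounded[of _ "integral\<^sup>L M B"])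
    fix m
    have "(\<Sum>i<m. \<integral>x. norm (F (e i) x) \<partial>M) = (\<integral>x. (\<Sum>i<m. norm (F (e i) x)) \<partial>M)"
      by (subst Bochner_Integration.integral_sum) (use int in auto)
    also have "\<dots> \<le> integral\<^sup>L M B"
      by (rule integral_mono) (use int bd B in auto)
    finally show "(\<Sum>i<m. \<integral>x. norm (F (e i) x) \<partial>M) \<le> integral\<^sup>L M B" .
  qed auto
  show "integrable M G" unfolding G
    by (rule integrable_suminf) (use int 1 2 in auto)
  have 3: "(\<lambda>i. integral\<^sup>L M (F (e i))) sums (\<integral>x. G x \<partial>M)" unfolding G
    by (rule sums_integral) (use int 1 2 in auto)
  have "summable (\<lambda>i. norm (integral\<^sup>L M (F (e i))))"
    by (rule summable_comparison_test'[OF 2, of 0]) (use integral_norm_bound in auto)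
  from norm_summable_imp_has_sum[OF this 3]
  show "((\<lambda>n. integral\<^sup>L M (F n)) has_sum integral\<^sup>L M G) UNIV"
    using has_sum_reindex_bij_betw[OF e, of "\<lambda>n. integral\<^sup>L M (F n)"] by simp
qed

text \<open>The function S of the overview with its removable singularity filled in: the Fourier
  transform of the indicator of [-T/2, T/2].\<close>

definition sker :: "real \<Rightarrow> real \<Rightarrow> real" where
  "sker T u = T * nsinc (T * u / (2 * pi))"

lemma nsinc_measurable [measurable]: "nsinc \<in> borel_measurable borel"
  unfolding nsinc_def[abs_def] by measurable

lemma sker_measurable [measurable]: "sker T \<in> borel_measurable borel"
  unfolding sker_def[abs_def] by measurable

lemma sker_minus [simp]: "sker T (- u) = sker T u"
  using nsinc_minus[of "T * u / (2 * pi)"] by (simp add: sker_def)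

lemma sker_commute: "sker T (x - y) = sker T (y - x)"
  using sker_minus[of T "x - y"] by simp

lemma sker_0 [simp]: "sker T 0 = T"
  by (simp add: sker_def nsinc_def)

lemma sker_scale: "sker T u = T * sker 1 (T * u)"
  by (simp add: sker_def)

lemma abs_sker_le: "T > 0 \<Longrightarrow> \<bar>sker T u\<bar> \<le> T"
  using abs_nsinc_le_1[of "T * u / (2 * pi)"] by (simp add: sker_def abs_mult mult_left_le)

text \<open>Rescaled cardinal sine identity. The nodes are the frequencies of
  \<open>fourier_basis\<close>, where the trace samples the kernels.\<close>

lemma sker_Parseval:
  assumes T: "T > 0"
  shows "((\<lambda>n::int. sker T (x - 2 * pi / T * of_int n) * sker T (2 * pi / T * of_int n - y)) has_sum (T * sker T (x - y))) UNIV"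
proof -
  have *: "T * (2 * pi / T * r - x) / (2 * pi) = - (T * x / (2 * pi)) + r" for x r
    using T by (simp add: field_simps)
  have "((\<lambda>n::int. (T * T) * (nsinc (- (T * x / (2 * pi)) + of_int n) * nsinc (- (T * y / (2 * pi)) + of_int n))) has_sum
     (T * T) * nsinc (- (T * x / (2 * pi)) - - (T * y / (2 * pi)))) UNIV"
    by (intro has_sum_cmult_right nsinc_Parseval_plus)
  moreover have "- (T * x / (2 * pi)) - - (T * y / (2 * pi)) = - (T * (x - y) / (2 * pi))"
    by (simp add: field_simps)
  moreover have "sker T (2 * pi / T * r - x) = T * nsinc (- (T * x / (2 * pi)) + r)" for r x
    unfolding sker_def * ..
  then have "sker T (x - 2 * pi / T * of_int n) * sker T (2 * pi / T * of_int n - y) =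
     (T * T) * (nsinc (- (T * x / (2 * pi)) + of_int n) * nsinc (- (T * y / (2 * pi)) + of_int n))" for n :: int
    unfolding sker_commute[of T x] by simp
  moreover have "(T * T) * nsinc (- (T * (x - y) / (2 * pi))) = T * sker T (x - y)"
    unfolding nsinc_minus sker_def by simp
  ultimately show ?thesis by (simp only:)
qed

text \<open>By the arithmetic-geometric inequality it suffices to treat x = y, where the terms are
  squares with total T * \<open>sker T 0\<close> = T^2.\<close>

lemma sker_Bessel:
  assumes T: "T > 0" and N: "finite N"
  shows "(\<Sum>n\<in>N. \<bar>sker T (x - 2 * pi / T * of_int n) * sker T (2 * pi / T * of_int n - y)\<bar>) \<le> T\<^sup>2"
proof -
  let ?w = "2 * pi / T"
  have *: "(\<Sum>n\<in>N. (sker T (x - ?w * of_int n))\<^sup>2) \<le> T\<^sup>2" for x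
  proof -
    have "(\<lambda>n::int. sker T (x - ?w * of_int n) * sker T (?w * of_int n - x)) = (\<lambda>n. (sker T (x - ?w * of_int n))\<^sup>2)"
      by (simp add: sker_commute[of T _ x] power2_eq_square)
    with sker_Parseval[OF T, of x x] have "((\<lambda>n::int. (sker T (x - ?w * of_int n))\<^sup>2) has_sum T\<^sup>2) UNIV"
      by (simp add: power2_eq_square)
    from finite_sum_le_has_sum[OF this N] show ?thesis by simp
  qed
  have "\<bar>a * b\<bar> \<le> (a\<^sup>2 + b\<^sup>2) / 2" for a b :: real
    using sum_squares_bound[of "\<bar>a\<bar>" "\<bar>b\<bar>"] by (simp add: abs_mult)
  then have "(\<Sum>n\<in>N. \<bar>sker T (x - ?w * of_int n) * sker T (?w * of_int n - y)\<bar>)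
     \<le> (\<Sum>n\<in>N. ((sker T (x - ?w * of_int n))\<^sup>2 + (sker T (?w * of_int n - y))\<^sup>2) / 2)"
    by (intro sum_mono) 
  also have "\<dots> = ((\<Sum>n\<in>N. (sker T (x - ?w * of_int n))\<^sup>2) + (\<Sum>n\<in>N. (sker T (y - ?w * of_int n))\<^sup>2)) / 2"
    unfolding sker_commute[of T _ y] by (simp add: sum.distrib flip: sum_divide_distrib)
  also have "\<dots> \<le> (T\<^sup>2 + T\<^sup>2) / 2" using *[of x] *[of y] by (intro divide_right_mono add_mono) auto
  finally show ?thesis by simp
qed

text \<open>From |nsinc x| \<le> 1 and |pi x nsinc x| \<le> 1 follows (1 + x^2) (nsinc x)^2 \<le> 2,
  an integrable majorant. The kernel itself is not absolutely integrable, so later convergence rests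
  on its square.\<close>

lemma integrable_sker_square:
  assumes T: "T > 0"
  shows "integrable lborel (\<lambda>u. (sker T u)\<^sup>2)"
proof -
  have 1: "integrable lborel (\<lambda>x::real. inverse (1 + x\<^sup>2))"
    using integrable_inverse_1_plus_square by (simp add: set_integrable_def einterval_iff)
  have "integrable lborel (\<lambda>x. (nsinc x)\<^sup>2)"
  proof (rule Bochner_Integration.integrable_bound[OF integrable_mult_right[OF 1, of 2]])
    show "AE x in lborel. norm ((nsinc x)\<^sup>2) \<le> norm (2 * inverse (1 + x\<^sup>2))"
    proof (rule AE_I2)
      fix x :: real
      have a: "(nsinc x)\<^sup>2 \<le> 1" using abs_nsinc_le_1[of x] by (simp add: abs_square_le_1)
      have "pi * x * nsinc x = sin (pi * x)" by (simp add: nsinc_def)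
      then have "\<bar>pi * x * nsinc x\<bar> \<le> 1" by simp
      then have "pi\<^sup>2 * (x\<^sup>2 * (nsinc x)\<^sup>2) \<le> 1" by (simp add: abs_square_le_1 flip: power_mult_distrib mult.assoc)
      moreover have "1 * (x\<^sup>2 * (nsinc x)\<^sup>2) \<le> pi\<^sup>2 * (x\<^sup>2 * (nsinc x)\<^sup>2)"
        by (rule mult_right_mono) (use pi_gt3 in \<open>auto simp: one_le_power\<close>)
      ultimately have "(1 + x\<^sup>2) * (nsinc x)\<^sup>2 \<le> 2" using a by (simp add: ring_distribs)
      then have "(nsinc x)\<^sup>2 \<le> 2 / (1 + x\<^sup>2)"
        by (subst pos_le_divide_eq) (auto simp: add_pos_nonneg mult.commute)
      then show "norm ((nsinc x)\<^sup>2) \<le> norm (2 * inverse (1 + x\<^sup>2))"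
        by (simp add: divide_inverse)
    qed
  qed auto
  from lborel_integrable_real_affine[OF this, of "T / (2 * pi)" 0]
  have "integrable lborel (\<lambda>u. (nsinc (T * u / (2 * pi)))\<^sup>2)" using T by simp
  then show ?thesis unfolding sker_def power_mult_distrib by (rule integrable_mult_right)
qed

lemma integrable_square_imp_integrable_mult:
  fixes f g :: "'a \<Rightarrow> real"
  assumes [measurable]: "f \<in> borel_measurable M" "g \<in> borel_measurable M"
    and "integrable M (\<lambda>x. (f x)\<^sup>2)" "integrable M (\<lambda>x. (g x)\<^sup>2)"
  shows "integrable M (\<lambda>x. f x * g x)"
proof (rule Bochner_Integration.integrable_bound[OF Bochner_Integration.integrable_add[OF assms(3,4)]])
  have "\<bar>a * b\<bar> \<le> a\<^sup>2 + b\<^sup>2" for a b :: real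
  proof -
    have "2 * \<bar>a * b\<bar> \<le> a\<^sup>2 + b\<^sup>2"
      using sum_squares_bound[of "\<bar>a\<bar>" "\<bar>b\<bar>"] by (simp add: abs_mult mult.assoc)
    then show ?thesis using abs_ge_zero[of "a * b"] by linarith
  qed
  then show "AE x in M. norm (f x * g x) \<le> norm ((f x)\<^sup>2 + (g x)\<^sup>2)"
    by (auto intro!: AE_I2)
qed measurable

lemma integrable_sker_shift_square:
  assumes T: "T > 0"
  shows "integrable lborel (\<lambda>z. (sker T (x - z))\<^sup>2)" "integrable lborel (\<lambda>z. (sker T (z - x))\<^sup>2)"
  using lborel_integrable_real_affine[OF integrable_sker_square[OF T], of "-1" x]
    sker_commute[of T x] by auto

lemma integrable_sker_product:
  assumes T: "T > 0"
  shows "integrable lborel (\<lambda>z. sker T (x - z) * sker T (z - y))"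
  by (rule integrable_square_imp_integrable_mult) (use integrable_sker_shift_square[OF T] in auto)

text \<open>Averaging the discrete Parseval identity over all shifts of the lattice.\<close>
lemma sker_reproducing:
  assumes T: "T > 0"
  shows "(\<integral>z. sker T (x - z) * sker T (z - y) \<partial>lborel) = 2 * pi * sker T (x - y)"
proof -
  define w where "w = 2 * pi / T"
  have w: "w > 0" using T by (simp add: w_def)
  define P where "P z = sker T (x - z) * sker T (z - y)" for z
  have [measurable]: "P \<in> borel_measurable borel" unfolding P_def by measurable
  have P: "integrable lborel P" unfolding P_def by (rule integrable_sker_product[OF T])
  define I where "I = (indicator {0..<w} :: real \<Rightarrow> real)"
  have [measurable]: "I \<in> borel_measurable borel" unfolding I_def by measurable
  have Iz: "I (z - w * of_int n) = (if n = \<lfloor>z / w\<rfloor> then 1 else 0)" for z and n :: int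
  proof -
    have "0 \<le> z - w * of_int n \<and> z - w * of_int n < w \<longleftrightarrow> of_int n \<le> z / w \<and> z / w < of_int n + 1"
      using w by (auto simp: field_simps)
    also have "\<dots> \<longleftrightarrow> n = \<lfloor>z / w\<rfloor>" by (metis floor_eq_iff)
    finally show ?thesis unfolding I_def by (auto simp: indicator_def)
  qed
  \<comment> \<open>The translates of [0, w) tile the line, so for each \<open>z\<close> exactly one
    term of the sum is nonzero.\<close>
  have s1: "((\<lambda>n::int. \<integral>z. I (z - w * of_int n) * P z \<partial>lborel) has_sum (\<integral>z. P z \<partial>lborel)) UNIV"
  proof (rule has_sum_integral_int[where B = "\<lambda>z. \<bar>P z\<bar>"])
    show "((\<lambda>n::int. I (z - w * of_int n) * P z) has_sum P z) UNIV" for z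
      by (rule has_sum_finite_neutralI[of "{\<lfloor>z / w\<rfloor>}"]) (auto simp: Iz)
    show "(\<Sum>n\<in>N. \<bar>I (z - w * of_int n) * P z\<bar>) \<le> \<bar>P z\<bar>" if "finite N" for N z
    proof -
      have "(\<Sum>n\<in>N. \<bar>I (z - w * of_int n) * P z\<bar>) = (\<Sum>n\<in>N. if n = \<lfloor>z / w\<rfloor> then \<bar>P z\<bar> else 0)"
        by (intro sum.cong) (auto simp: Iz)
      also have "\<dots> \<le> \<bar>P z\<bar>" using that by simp
      finally show ?thesis .
    qed
  qed (use P in auto)
  \<comment> \<open>Shifting the lattice by \<open>a\<close> amounts to shifting \<open>x\<close>
    and \<open>y\<close> by -a; the difference x - y is unchanged, so the inner sum does not depend
    on \<open>a\<close>.\<close>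
  have s2: "((\<lambda>n::int. \<integral>a. I a * P (a + w * of_int n) \<partial>lborel) has_sum (\<integral>a. I a * (T * sker T (x - y)) \<partial>lborel)) UNIV"
  proof (rule has_sum_integral_int[where B = "\<lambda>a. I a * T\<^sup>2"])
    have e: "P (a + w * of_int n) = sker T ((x - a) - 2 * pi / T * of_int n) * sker T (2 * pi / T * of_int n - (y - a))" for a n
      by (simp add: P_def w_def algebra_simps)
    show "((\<lambda>n::int. I a * P (a + w * of_int n)) has_sum I a * (T * sker T (x - y))) UNIV" for a
      unfolding e using sker_Parseval[OF T, of "x - a" "y - a"] by (intro has_sum_cmult_right) simp
    show "(\<Sum>n\<in>N. \<bar>I a * P (a + w * of_int n)\<bar>) \<le> I a * T\<^sup>2" if "finite N" for N a
      using mult_left_mono[OF sker_Bessel[OF T that, of "x - a" "y - a"], of "I a"]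
      unfolding e by (simp add: abs_mult sum_distrib_left I_def)
    show "integrable lborel (\<lambda>a. I a * T\<^sup>2)" unfolding I_def using w by auto
  qed measurable
  have "(\<integral>z. I (z - w * of_int n) * P z \<partial>lborel) = (\<integral>a. I a * P (a + w * of_int n) \<partial>lborel)" for n :: int
    using lborel_integral_real_affine[of 1 "\<lambda>z. I (z - w * of_int n) * P z" "w * of_int n"]
    by (simp add: add.commute)
  with s1 s2 have "(\<integral>z. P z \<partial>lborel) = (\<integral>a. I a * (T * sker T (x - y)) \<partial>lborel)"
    using has_sum_unique by fastforce
  \<comment> \<open>The cell has length w = 2 pi / T, so the constant 2 pi is cell length times
    T.\<close>
  also have "\<dots> = w * (T * sker T (x - y))" unfolding I_def using w by simp
  also have "\<dots> = 2 * pi * sker T (x - y)" using T by (simp add: w_def)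
  finally show ?thesis unfolding P_def .
qed

section \<open>Cyclic multilinear forms\<close>

lemma integrable_mult_bounded:
  fixes f g :: "'a \<Rightarrow> real"
  assumes f: "integrable M f" and [measurable]: "g \<in> borel_measurable M" and b: "\<And>x. \<bar>g x\<bar> \<le> B"
  shows "integrable M (\<lambda>x. g x * f x)"
proof (rule Bochner_Integration.integrable_bound[OF integrable_mult_right[OF integrable_abs[OF f], of B]])
  have "\<bar>g x\<bar> * \<bar>f x\<bar> \<le> \<bar>B\<bar> * \<bar>f x\<bar>" for x
    by (rule mult_right_mono[OF order_trans[OF b abs_ge_self]]) simp
  then show "AE x in M. norm (g x * f x) \<le> norm (B * \<bar>f x\<bar>)"
    by (intro AE_I2) (simp add: abs_mult)
qed (use f in measurable)

lemma integral_mult_bounded_le: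
  fixes f g :: "'a \<Rightarrow> real"
  assumes f: "integrable M f" and b: "\<And>x. \<bar>g x\<bar> \<le> B"
  shows "\<bar>\<integral>x. g x * f x \<partial>M\<bar> \<le> B * (\<integral>x. \<bar>f x\<bar> \<partial>M)"
proof (cases "integrable M (\<lambda>x. g x * f x)")
  case True
  have "\<bar>\<integral>x. g x * f x \<partial>M\<bar> \<le> (\<integral>x. \<bar>g x * f x\<bar> \<partial>M)" by (rule integral_abs_bound)
  also have "\<dots> \<le> (\<integral>x. B * \<bar>f x\<bar> \<partial>M)"
    using b by (intro integral_mono integrable_abs[OF True] integrable_mult_right integrable_abs[OF f])
      (auto simp: abs_mult intro!: mult_right_mono)
  finally show ?thesis by simp
next
  \<comment> \<open>A non-integrable product has integral 0 by convention, so the estimate reduces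
    to B >= 0.\<close>
  case False
  have "0 \<le> B" using b[of undefined] abs_ge_zero order_trans by blast
  with False show ?thesis by (simp add: not_integrable_integral_eq)
qed

text \<open>Integrating |G| over z first leaves at most C |v u|. A column bound uniform in u is what
  Cauchy-Schwarz yields for products of two factors S.\<close>

lemma Fubini_kernel:
  fixes v :: "real \<Rightarrow> real" and G :: "real \<Rightarrow> real \<Rightarrow> real"
  assumes v: "integrable lborel v"
    and G [measurable]: "(\<lambda>(z, u). G z u) \<in> borel_measurable (borel \<Otimes>\<^sub>M borel)"
    and i: "\<And>u. integrable lborel (\<lambda>z. G z u)"
    and C: "\<And>u. (\<integral>z. \<bar>G z u\<bar> \<partial>lborel) \<le> C"
  shows "integrable (lborel \<Otimes>\<^sub>M lborel) (\<lambda>(z, u). G z u * v u)"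
    and "(\<integral>z. (\<integral>u. G z u * v u \<partial>lborel) \<partial>lborel) = (\<integral>u. (\<integral>z. G z u \<partial>lborel) * v u \<partial>lborel)"
proof -
  have [measurable]: "v \<in> borel_measurable borel" using v by auto
  have m: "(\<lambda>(u, z). G z u * v u) \<in> borel_measurable (lborel \<Otimes>\<^sub>M lborel)" by measurable
  have swapped: "integrable (lborel \<Otimes>\<^sub>M lborel) (\<lambda>(u, z). G z u * v u)"
  proof (rule lborel_pair.Fubini_integrable[OF m])
    have "integrable lborel (\<lambda>u. (\<integral>z. \<bar>G z u\<bar> \<partial>lborel) * \<bar>v u\<bar>)"
      by (rule integrable_mult_bounded[where B=C]) (use v C in \<open>auto simp: integral_nonneg_AE\<close>)
    then show "integrable lborel (\<lambda>x. \<integral>y. norm (case (x, y) of (u, z) \<Rightarrow> G z u * v u) \<partial>lborel)"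
      by (simp add: abs_mult)
    show "AE x in lborel. integrable lborel (\<lambda>y. case (x, y) of (u, z) \<Rightarrow> G z u * v u)"
      using i by auto
  qed
  then show *: "integrable (lborel \<Otimes>\<^sub>M lborel) (\<lambda>(z, u). G z u * v u)"
    using lborel_pair.integrable_product_swap[OF swapped] by simp
  show "(\<integral>z. (\<integral>u. G z u * v u \<partial>lborel) \<partial>lborel) = (\<integral>u. (\<integral>z. G z u \<partial>lborel) * v u \<partial>lborel)"
    using lborel_pair.Fubini_integral[OF *] i by simp
qed

lemma Fubini_bounded:
  fixes a v :: "real \<Rightarrow> real" and G :: "real \<Rightarrow> real \<Rightarrow> real"
  assumes a: "integrable lborel a" and v: "integrable lborel v"
    and G [measurable]: "(\<lambda>(z, u). G z u) \<in> borel_measurable (borel \<Otimes>\<^sub>M borel)"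
    and b: "\<And>z u. \<bar>G z u\<bar> \<le> B"
  shows "integrable (lborel \<Otimes>\<^sub>M lborel) (\<lambda>(z, u). G z u * a z * v u)"
    and "(\<integral>z. (\<integral>u. G z u * a z * v u \<partial>lborel) \<partial>lborel) = (\<integral>u. (\<integral>z. G z u * a z \<partial>lborel) * v u \<partial>lborel)"
proof -
  have [measurable]: "a \<in> borel_measurable borel" using a by auto
  have m: "(\<lambda>(z, u). G z u * a z) \<in> borel_measurable (borel \<Otimes>\<^sub>M borel)" by measurable
  have i: "integrable lborel (\<lambda>z. G z u * a z)" for u
    by (rule integrable_mult_bounded[OF a _ b]) measurable
  have c: "(\<integral>z. \<bar>G z u * a z\<bar> \<partial>lborel) \<le> B * (\<integral>z. \<bar>a z\<bar> \<partial>lborel)" for u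
  proof -
    have "(\<integral>z. \<bar>G z u * a z\<bar> \<partial>lborel) \<le> (\<integral>z. B * \<bar>a z\<bar> \<partial>lborel)"
      using b by (intro integral_mono integrable_abs[OF i] integrable_mult_right integrable_abs[OF a])
        (auto simp: abs_mult intro!: mult_right_mono)
    then show ?thesis by simp
  qed
  show "integrable (lborel \<Otimes>\<^sub>M lborel) (\<lambda>(z, u). G z u * a z * v u)"
    "(\<integral>z. (\<integral>u. G z u * a z * v u \<partial>lborel) \<partial>lborel) = (\<integral>u. (\<integral>z. G z u * a z \<partial>lborel) * v u \<partial>lborel)"
    using Fubini_kernel[OF v m i c] by auto
qed

lemma Cauchy_Schwarz_integral:
  fixes f g :: "'a \<Rightarrow> real"
  assumes [measurable]: "f \<in> borel_measurable M" "g \<in> borel_measurable M"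
    and f2: "integrable M (\<lambda>x. (f x)\<^sup>2)" and g2: "integrable M (\<lambda>x. (g x)\<^sup>2)"
  shows "(\<integral>x. \<bar>f x * g x\<bar> \<partial>M) \<le> sqrt (\<integral>x. (f x)\<^sup>2 \<partial>M) * sqrt (\<integral>x. (g x)\<^sup>2 \<partial>M)"
proof -
  define A B where "A = (\<integral>x. (f x)\<^sup>2 \<partial>M)" and "B = (\<integral>x. (g x)\<^sup>2 \<partial>M)"
  have AB: "A \<ge> 0" "B \<ge> 0" unfolding A_def B_def by auto
  have fg: "integrable M (\<lambda>x. \<bar>f x * g x\<bar>)"
    by (intro integrable_abs integrable_square_imp_integrable_mult f2 g2) measurable
  have "(\<integral>\<^sup>+x. ennreal \<bar>f x\<bar> * ennreal \<bar>g x\<bar> \<partial>M)\<^sup>2 \<le> (\<integral>\<^sup>+x. (ennreal \<bar>f x\<bar>)\<^sup>2 \<partial>M) * (\<integral>\<^sup>+x. (ennreal \<bar>g x\<bar>)\<^sup>2 \<partial>M)"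
    by (rule Cauchy_Schwarz_nn_integral) measurable
  also have "(\<integral>\<^sup>+x. (ennreal \<bar>f x\<bar>)\<^sup>2 \<partial>M) = ennreal A"
    unfolding A_def by (subst nn_integral_eq_integral[symmetric, OF f2]) (auto simp: ennreal_power)
  also have "(\<integral>\<^sup>+x. (ennreal \<bar>g x\<bar>)\<^sup>2 \<partial>M) = ennreal B"
    unfolding B_def by (subst nn_integral_eq_integral[symmetric, OF g2]) (auto simp: ennreal_power)
  also have "(\<integral>\<^sup>+x. ennreal \<bar>f x\<bar> * ennreal \<bar>g x\<bar> \<partial>M) = ennreal (\<integral>x. \<bar>f x * g x\<bar> \<partial>M)"
    by (subst nn_integral_eq_integral[symmetric, OF fg]) (auto simp: ennreal_mult' abs_mult)
  finally have "(\<integral>x. \<bar>f x * g x\<bar> \<partial>M)\<^sup>2 \<le> A * B"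
    using AB by (simp add: ennreal_power flip: ennreal_mult)
  then show ?thesis unfolding A_def[symmetric] B_def[symmetric] real_sqrt_mult[symmetric]
    by (rule real_le_rsqrt)
qed

text \<open>Integral kernel of S h_1 S h_2 ... h_m S: multiplication operators alternate with
  convolutions, and both outer factors are S.\<close>

fun ker :: "real \<Rightarrow> (real \<Rightarrow> real) list \<Rightarrow> real \<Rightarrow> real \<Rightarrow> real" where
  "ker T [] x y = sker T (x - y)"
| "ker T (h # hs) x y = (\<integral>z. sker T (x - z) * h z * ker T hs z y \<partial>lborel)"

text \<open>The trace of h_1 S h_2 S ... h_m S; a single symbol gives T times its integral.\<close>

fun cyc :: "real \<Rightarrow> (real \<Rightarrow> real) list \<Rightarrow> real" where
  "cyc T [] = 0"
| "cyc T (h # hs) = (\<integral>x. h x * ker T hs x x \<partial>lborel)"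

lemma ker_measurable_pair:
  assumes "\<forall>h\<in>set hs. integrable lborel h"
  shows "(\<lambda>(x, y). ker T hs x y) \<in> borel_measurable (borel \<Otimes>\<^sub>M borel)"
  using assms
proof (induction hs)
  case Nil
  show ?case by simp
next
  case (Cons h hs)
  then have [measurable]: "(\<lambda>(x, y). ker T hs x y) \<in> borel_measurable (borel \<Otimes>\<^sub>M borel)"
    "h \<in> borel_measurable borel" by auto
  show ?case by simp
qed

text \<open>Composing joint measurability with arbitrary \<open>f\<close> and \<open>g\<close>
  covers sections in either variable and the diagonal at once.\<close>

lemma ker_measurable:
  assumes "\<forall>h\<in>set hs. integrable lborel h" and "f \<in> borel_measurable M" "g \<in> borel_measurable M"
  shows "(\<lambda>w. ker T hs (f w) (g w)) \<in> borel_measurable M"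
  using measurable_compose[OF measurable_Pair[OF assms(2,3)] ker_measurable_pair[OF assms(1)]] by simp

text \<open>A crude bound growing like a power of T that increases with the number of symbols. It
  serves integrability and dominated convergence at fixed T; the bound linear in T is
  \<open>ker_diagonal_le\<close>.\<close>

lemma abs_ker_le:
  assumes T: "T > 0" and "\<forall>h\<in>set hs. integrable lborel h"
  shows "\<bar>ker T hs x y\<bar> \<le> T * (\<Prod>h\<leftarrow>hs. T * (\<integral>z. \<bar>h z\<bar> \<partial>lborel))"
  using assms(2)
proof (induction hs arbitrary: x)
  case Nil
  then show ?case using abs_sker_le[OF T] by simp
next
  case (Cons h hs)
  let ?B = "T * (\<Prod>h\<leftarrow>hs. T * (\<integral>z. \<bar>h z\<bar> \<partial>lborel))"
  have "\<bar>sker T (x - z) * ker T hs z y\<bar> \<le> T * ?B" for z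
    unfolding abs_mult using Cons abs_sker_le[OF T] T by (intro mult_mono) auto
  from integral_mult_bounded_le[of lborel h, OF _ this]
  have "\<bar>\<integral>z. sker T (x - z) * ker T hs z y * h z \<partial>lborel\<bar> \<le> T * ?B * (\<integral>z. \<bar>h z\<bar> \<partial>lborel)"
    using Cons.prems by simp
  then show ?case by (simp add: mult_ac)
qed

lemma integrable_ker_integrand:
  assumes T: "T > 0" and "integrable lborel h" and "\<forall>h\<in>set hs. integrable lborel h"
  shows "integrable lborel (\<lambda>z. h z * ker T hs z y)" "integrable lborel (\<lambda>z. sker T (x - z) * h z * ker T hs z y)"
    "integrable lborel (\<lambda>z. h z * ker T hs z z)"
proof -
  note [measurable] = ker_measurable[OF assms(3)]
  show *: "integrable lborel (\<lambda>z. h z * ker T hs z y)"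
    using integrable_mult_bounded[OF assms(2), of "\<lambda>z. ker T hs z y", OF _ abs_ker_le[OF T assms(3)]]
    by (simp add: mult.commute)
  show "integrable lborel (\<lambda>z. sker T (x - z) * h z * ker T hs z y)"
    unfolding mult.assoc by (rule integrable_mult_bounded[OF * _ abs_sker_le[OF T]]) measurable
  show "integrable lborel (\<lambda>z. h z * ker T hs z z)"
    using integrable_mult_bounded[OF assms(2), of "\<lambda>z. ker T hs z z", OF _ abs_ker_le[OF T assms(3)]]
    by (simp add: mult.commute)
qed

text \<open>Recursion from the right end. Together with the defining recursion it exposes both outer
  factors S, as cyclicity and the trace computation require.\<close>

lemma ker_snoc:
  assumes T: "T > 0" and "\<forall>h\<in>set hs. integrable lborel h" and h: "integrable lborel h"
  shows "ker T (hs @ [h]) x y = (\<integral>z. ker T hs x z * h z * sker T (z - y) \<partial>lborel)"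
  using assms(2)
proof (induction hs arbitrary: x)
  case Nil
  show ?case by simp
next
  case (Cons a hs)
  let ?G = "\<lambda>u z. sker T (x - u) * ker T hs u z * sker T (z - y)"
  have a: "integrable lborel a" and hs: "\<forall>h\<in>set hs. integrable lborel h" using Cons.prems by auto
  note [measurable] = ker_measurable[OF hs]
  let ?B = "T * (T * (\<Prod>h\<leftarrow>hs. T * (\<integral>z. \<bar>h z\<bar> \<partial>lborel))) * T"
  have "\<bar>?G u z\<bar> \<le> ?B" for u z
    unfolding abs_mult using abs_ker_le[OF T hs, of u z] abs_sker_le[OF T] T by (intro mult_mono) auto
  from Fubini_bounded(2)[OF a h _ this]
  have *: "(\<integral>u. (\<integral>z. ?G u z * a u * h z \<partial>lborel) \<partial>lborel) = (\<integral>z. (\<integral>u. ?G u z * a u \<partial>lborel) * h z \<partial>lborel)"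
    by measurable
  have "ker T ((a # hs) @ [h]) x y = (\<integral>u. sker T (x - u) * a u * (\<integral>z. ker T hs u z * h z * sker T (z - y) \<partial>lborel) \<partial>lborel)"
    using Cons.IH hs by simp
  also have "\<dots> = (\<integral>u. (\<integral>z. ?G u z * a u * h z \<partial>lborel) \<partial>lborel)"
    by (simp add: mult_ac flip: integral_mult_right_zero)
  also have "\<dots> = (\<integral>z. (\<integral>u. sker T (x - u) * a u * ker T hs u z \<partial>lborel) * h z * sker T (z - y) \<partial>lborel)"
    unfolding * by (simp add: mult_ac flip: integral_mult_right_zero)
  finally show ?case by simp
qed

text \<open>Cyclicity of the trace is an exchange of the outermost two integrals, once
  \<open>ker_snoc\<close> has isolated the last symbol.\<close>

lemma cyc_rotate1:
  assumes T: "T > 0" and hs: "\<forall>h\<in>set hs. integrable lborel h" and h: "integrable lborel h"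
  shows "cyc T (hs @ [h]) = cyc T (h # hs)"
proof (cases hs)
  case Nil
  then show ?thesis by simp
next
  case (Cons a as)
  have a: "integrable lborel a" and as: "\<forall>h\<in>set as. integrable lborel h" using hs Cons by auto
  note [measurable] = ker_measurable[OF as]
  let ?G = "\<lambda>x z. ker T as x z * sker T (z - x)"
  let ?B = "(T * (\<Prod>h\<leftarrow>as. T * (\<integral>z. \<bar>h z\<bar> \<partial>lborel))) * T"
  have "\<bar>?G x z\<bar> \<le> ?B" for x z
    unfolding abs_mult using abs_ker_le[OF T as, of x z] abs_sker_le[OF T] T by (intro mult_mono) auto
  from Fubini_bounded(2)[OF a h _ this]
  have *: "(\<integral>u. (\<integral>z. ?G u z * a u * h z \<partial>lborel) \<partial>lborel) = (\<integral>z. (\<integral>u. ?G u z * a u \<partial>lborel) * h z \<partial>lborel)"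
    by measurable
  have "cyc T (hs @ [h]) = (\<integral>u. (\<integral>z. ?G u z * a u * h z \<partial>lborel) \<partial>lborel)"
    using ker_snoc[OF T as h] Cons by (simp add: mult_ac flip: integral_mult_right_zero)
  also have "\<dots> = cyc T (h # hs)"
    unfolding * using Cons by (simp add: mult_ac)
  finally show ?thesis .
qed

lemma cyc_rotate:
  assumes T: "T > 0" and "\<forall>h\<in>set xs. integrable lborel h" "\<forall>h\<in>set ys. integrable lborel h"
  shows "cyc T (xs @ ys) = cyc T (ys @ xs)"
  using assms(2,3)
proof (induction ys arbitrary: xs rule: rev_induct)
  case Nil
  show ?case by simp
next
  case (snoc y ys)
  have "cyc T (xs @ ys @ [y]) = cyc T ((y # xs) @ ys)"
    using cyc_rotate1[OF T, of "xs @ ys" y] snoc.prems by auto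
  also have "\<dots> = cyc T (ys @ y # xs)" using snoc.prems by (intro snoc.IH) auto
  finally show ?case by simp
qed

section \<open>Square-integrable bounds and continuity of translations\<close>

lemma integral_sker_square: 
  assumes T: "T > 0"
  shows "(\<integral>z. (sker T (x - z))\<^sup>2 \<partial>lborel) = 2 * pi * T" "(\<integral>z. (sker T (z - x))\<^sup>2 \<partial>lborel) = 2 * pi * T"
proof -
  have e: "(sker T (x - z))\<^sup>2 = sker T (x - z) * sker T (z - x)" for z
    using sker_commute[of T x z] by (simp add: power2_eq_square)
  show "(\<integral>z. (sker T (x - z))\<^sup>2 \<partial>lborel) = 2 * pi * T"
    unfolding e using sker_reproducing[OF T, of x x] by simp
  then show "(\<integral>z. (sker T (z - x))\<^sup>2 \<partial>lborel) = 2 * pi * T"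
    unfolding sker_commute[of T _ x] .
qed

lemma integral_abs_sker_product_le:
  assumes T: "T > 0"
  shows "(\<integral>z. \<bar>sker T (x - z) * sker T (z - u)\<bar> \<partial>lborel) \<le> 2 * pi * T"
proof -
  have "(\<integral>z. \<bar>sker T (x - z) * sker T (z - u)\<bar> \<partial>lborel) \<le> sqrt (2 * pi * T) * sqrt (2 * pi * T)"
    using Cauchy_Schwarz_integral[of "\<lambda>z. sker T (x - z)" lborel "\<lambda>z. sker T (z - u)"]
    by (simp add: integrable_sker_shift_square[OF T] integral_sker_square[OF T])
  then show ?thesis using T by simp
qed

text \<open>Equals 2 pi times the orthogonal projection onto functions whose Fourier transform is
  supported in [-T/2, T/2].\<close>

definition proj :: "real \<Rightarrow> (real \<Rightarrow> real) \<Rightarrow> real \<Rightarrow> real" where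
  "proj T v x = (\<integral>u. sker T (x - u) * v u \<partial>lborel)"

lemma proj_measurable:
  assumes "integrable lborel v"
  shows "proj T v \<in> borel_measurable borel"
proof -
  have [measurable]: "v \<in> borel_measurable borel" using assms by auto
  show ?thesis unfolding proj_def[abs_def] by measurable
qed

text \<open>The square of the operator is 2 pi times itself, by exchanging integrals. The third
  clause is the column bound under which \<open>Fubini_kernel\<close> applies in
  \<open>proj_L2\<close>.\<close>

lemma proj_reproducing:
  assumes T: "T > 0" and v: "integrable lborel v"
  shows "integrable lborel (\<lambda>z. sker T (x - z) * proj T v z)"
    and "(\<integral>z. sker T (x - z) * proj T v z \<partial>lborel) = 2 * pi * proj T v x"
    and "(\<integral>z. \<bar>sker T (x - z) * proj T v z\<bar> \<partial>lborel) \<le> 2 * pi * T * (\<integral>u. \<bar>v u\<bar> \<partial>lborel)"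
proof -
  have [measurable]: "v \<in> borel_measurable borel" using v by auto
  note [measurable] = proj_measurable[OF v]
  let ?G = "\<lambda>z u. sker T (x - z) * sker T (z - u)"
  have m: "(\<lambda>(z, u). ?G z u) \<in> borel_measurable (borel \<Otimes>\<^sub>M borel)"
    "(\<lambda>(z, u). \<bar>?G z u\<bar>) \<in> borel_measurable (borel \<Otimes>\<^sub>M borel)" by measurable
  note i = integrable_sker_product[OF T, of x]
  note c = integral_abs_sker_product_le[OF T, of x]
  have c': "(\<integral>z. \<bar>\<bar>?G z u\<bar>\<bar> \<partial>lborel) \<le> 2 * pi * T" for u using c by simp
  note F = Fubini_kernel[OF v m(1) i c]
  note A = Fubini_kernel[OF integrable_abs[OF v] m(2) integrable_abs[OF i] c']
  have e: "(\<integral>u. ?G z u * v u \<partial>lborel) = sker T (x - z) * proj T v z" for z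
    unfolding proj_def by (simp add: mult.assoc)
  show int: "integrable lborel (\<lambda>z. sker T (x - z) * proj T v z)"
    using lborel_pair.integrable_fst[OF F(1)] unfolding e .
  show "(\<integral>z. sker T (x - z) * proj T v z \<partial>lborel) = 2 * pi * proj T v x"
    using F(2) unfolding e sker_reproducing[OF T] by (simp add: proj_def mult.assoc)
  have "(\<integral>z. \<bar>sker T (x - z) * proj T v z\<bar> \<partial>lborel) \<le> (\<integral>z. (\<integral>u. \<bar>?G z u\<bar> * \<bar>v u\<bar> \<partial>lborel) \<partial>lborel)"
  proof (rule integral_mono)
    show "integrable lborel (\<lambda>z. \<integral>u. \<bar>?G z u\<bar> * \<bar>v u\<bar> \<partial>lborel)"
      using lborel_pair.integrable_fst[OF A(1)] .
    show "\<bar>sker T (x - z) * proj T v z\<bar> \<le> (\<integral>u. \<bar>?G z u\<bar> * \<bar>v u\<bar> \<partial>lborel)" for z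
      unfolding e[symmetric] abs_mult[symmetric] by (rule integral_abs_bound)
  qed (use int in auto)
  also have "\<dots> = (\<integral>u. (\<integral>z. \<bar>?G z u\<bar> \<partial>lborel) * \<bar>v u\<bar> \<partial>lborel)" by (rule A(2))
  also have "\<dots> \<le> \<bar>\<integral>u. (\<integral>z. \<bar>?G z u\<bar> \<partial>lborel) * \<bar>v u\<bar> \<partial>lborel\<bar>" by simp
  also have "\<dots> \<le> 2 * pi * T * (\<integral>u. \<bar>\<bar>v u\<bar>\<bar> \<partial>lborel)"
    by (rule integral_mult_bounded_le) (use v c in auto)
  finally show "(\<integral>z. \<bar>sker T (x - z) * proj T v z\<bar> \<partial>lborel) \<le> 2 * pi * T * (\<integral>u. \<bar>v u\<bar> \<partial>lborel)" by simp
qed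

lemma proj_L2:
  assumes T: "T > 0" and v: "integrable lborel v" and v2: "integrable lborel (\<lambda>x. (v x)\<^sup>2)"
  shows "integrable lborel (\<lambda>z. (proj T v z)\<^sup>2)"
    and "(\<integral>z. (proj T v z)\<^sup>2 \<partial>lborel) \<le> (2 * pi)\<^sup>2 * (\<integral>z. (v z)\<^sup>2 \<partial>lborel)"
proof -
  have [measurable]: "v \<in> borel_measurable borel" using v by auto
  note [measurable] = proj_measurable[OF v]
  let ?G = "\<lambda>z u. sker T (z - u) * proj T v z"
  have m: "(\<lambda>(z, u). ?G z u) \<in> borel_measurable (borel \<Otimes>\<^sub>M borel)" by measurable
  have i: "integrable lborel (\<lambda>z. ?G z u)" and c: "(\<integral>z. \<bar>?G z u\<bar> \<partial>lborel) \<le> 2 * pi * T * (\<integral>u. \<bar>v u\<bar> \<partial>lborel)"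
    and r: "(\<integral>z. ?G z u \<partial>lborel) = 2 * pi * proj T v u" for u
    unfolding sker_commute[of T _ u] by (rule proj_reproducing[OF T v])+
  note F = Fubini_kernel[OF v m i c]
  have "(\<integral>u. ?G z u * v u \<partial>lborel) = (\<integral>u. (sker T (z - u) * v u) * proj T v z \<partial>lborel)" for z
    by (intro Bochner_Integration.integral_cong) auto
  then have e: "(\<integral>u. ?G z u * v u \<partial>lborel) = (proj T v z)\<^sup>2" for z
    by (simp add: power2_eq_square proj_def)
  show int: "integrable lborel (\<lambda>z. (proj T v z)\<^sup>2)"
    using lborel_pair.integrable_fst[OF F(1)] unfolding e .
  \<comment> \<open>Self-adjointness and the reproducing property: the square of the norm of Pv is 2
    pi times the inner product of Pv with v.\<close>
  have "(\<integral>z. (proj T v z)\<^sup>2 \<partial>lborel) = (\<integral>u. 2 * pi * proj T v u * v u \<partial>lborel)"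
    using F(2) unfolding e r .
  \<comment> \<open>Half of the left-hand integral reappears on the right and is absorbed; it is
    already known to be finite.\<close>
  also have "\<dots> \<le> (\<integral>u. ((2 * pi)\<^sup>2 * (v u)\<^sup>2 + (proj T v u)\<^sup>2) / 2 \<partial>lborel)"
  proof (rule integral_mono)
    show "integrable lborel (\<lambda>u. 2 * pi * proj T v u * v u)"
      by (subst mult.assoc) (intro integrable_mult_right integrable_square_imp_integrable_mult int v2; measurable)
    show "integrable lborel (\<lambda>u. ((2 * pi)\<^sup>2 * (v u)\<^sup>2 + (proj T v u)\<^sup>2) / 2)"
      using int v2 by auto
    fix u
    show "2 * pi * proj T v u * v u \<le> ((2 * pi)\<^sup>2 * (v u)\<^sup>2 + (proj T v u)\<^sup>2) / 2"
      using sum_squares_bound[of "2 * pi * v u" "proj T v u"] by (simp add: power_mult_distrib mult_ac)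
  qed
  also have "\<dots> = ((2 * pi)\<^sup>2 * (\<integral>u. (v u)\<^sup>2 \<partial>lborel) + (\<integral>u. (proj T v u)\<^sup>2 \<partial>lborel)) / 2"
    using int v2 by simp
  finally show "(\<integral>z. (proj T v z)\<^sup>2 \<partial>lborel) \<le> (2 * pi)\<^sup>2 * (\<integral>z. (v z)\<^sup>2 \<partial>lborel)" by simp
qed

lemma ker_Cons_eq_proj: "ker T (h # hs) x y = proj T (\<lambda>z. h z * ker T hs z y) x"
  by (simp add: proj_def mult.assoc)

text \<open>Every \<open>ker T hs\<close> begins with a factor S, so one more S on the left only
  contributes 2 pi. This collapses two neighbouring S when the symbol between them is pulled
  out.\<close>

lemma ker_reproducing:
  assumes T: "T > 0" and hs: "\<forall>h\<in>set hs. integrable lborel h"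
  shows "integrable lborel (\<lambda>z. sker T (x - z) * ker T hs z y)"
    and "(\<integral>z. sker T (x - z) * ker T hs z y \<partial>lborel) = 2 * pi * ker T hs x y"
proof -
  have "integrable lborel (\<lambda>z. sker T (x - z) * ker T hs z y) \<and>
     (\<integral>z. sker T (x - z) * ker T hs z y \<partial>lborel) = 2 * pi * ker T hs x y"
  proof (cases hs)
    case Nil
    then show ?thesis using integrable_sker_product[OF T] sker_reproducing[OF T] by simp
  next
    case (Cons h as)
    then have "integrable lborel (\<lambda>z. h z * ker T as z y)"
      using hs integrable_ker_integrand(1)[OF T] by simp
    from proj_reproducing(1,2)[OF T this] show ?thesis unfolding Cons ker_Cons_eq_proj by simp
  qed
  then show "integrable lborel (\<lambda>z. sker T (x - z) * ker T hs z y)"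
    "(\<integral>z. sker T (x - z) * ker T hs z y \<partial>lborel) = 2 * pi * ker T hs x y" by auto
qed

section \<open>Bounds for iterated kernels with bounded symbols\<close>

abbreviation bounded_integrable :: "(real \<Rightarrow> real) \<Rightarrow> real \<Rightarrow> bool" where
  "bounded_integrable h b \<equiv> integrable lborel h \<and> (\<forall>x. \<bar>h x\<bar> \<le> b)"

lemma list_all2_bounded_integrable:
  "list_all2 bounded_integrable hs bs \<Longrightarrow> \<forall>h\<in>set hs. integrable lborel h"
  by (induction rule: list_all2_induct) auto

lemma prod_list_bounds_nonneg:
  "list_all2 bounded_integrable hs bs \<Longrightarrow> 0 \<le> prod_list bs"
proof (induction rule: list_all2_induct)
  case (Cons h hs b bs)
  have "0 \<le> b" using Cons(1) abs_ge_zero order_trans by blast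
  with Cons show ?case by simp
qed simp

lemma integrable_bounded_mult_square:
  fixes f :: "'a \<Rightarrow> real"
  assumes [measurable]: "h \<in> borel_measurable M" "f \<in> borel_measurable M"
    and f2: "integrable M (\<lambda>z. (f z)\<^sup>2)" and b: "\<And>x. \<bar>h x\<bar> \<le> b"
  shows "integrable M (\<lambda>z. (h z * f z)\<^sup>2)"
    and "(\<integral>z. (h z * f z)\<^sup>2 \<partial>M) \<le> b\<^sup>2 * (\<integral>z. (f z)\<^sup>2 \<partial>M)"
proof -
  have b2: "\<bar>(h x)\<^sup>2\<bar> \<le> b\<^sup>2" for x using power_mono[OF b[of x], of 2] by simp
  show "integrable M (\<lambda>z. (h z * f z)\<^sup>2)"
    unfolding power_mult_distrib by (rule integrable_mult_bounded[OF f2 _ b2]) measurable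
  show "(\<integral>z. (h z * f z)\<^sup>2 \<partial>M) \<le> b\<^sup>2 * (\<integral>z. (f z)\<^sup>2 \<partial>M)"
    unfolding power_mult_distrib using integral_mult_bounded_le[OF f2 b2] by simp
qed

text \<open>The rightmost S has squared norm 2 pi T; each multiplication by a symbol costs its bound
  and each further convolution costs 2 pi. The norm thus grows only like the square root of
  T.\<close>

lemma ker_L2:
  assumes T: "T > 0" and "list_all2 bounded_integrable hs bs"
  shows "integrable lborel (\<lambda>z. (ker T hs z y)\<^sup>2) \<and>
    (\<integral>z. (ker T hs z y)\<^sup>2 \<partial>lborel) \<le> 2 * pi * T * ((2 * pi) ^ length hs * prod_list bs)\<^sup>2"
  using assms(2)
proof (induction rule: list_all2_induct)
  case Nil
  then show ?case using integrable_sker_shift_square[OF T] integral_sker_square[OF T] by simp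
next
  case (Cons h hs b bs)
  have hs: "\<forall>h\<in>set hs. integrable lborel h" using Cons(2) by (rule list_all2_bounded_integrable)
  have h: "integrable lborel h" "\<And>x. \<bar>h x\<bar> \<le> b" using Cons(1) by auto
  have [measurable]: "h \<in> borel_measurable borel" using h by auto
  note [measurable] = ker_measurable[OF hs]
  have v: "integrable lborel (\<lambda>z. h z * ker T hs z y)" using integrable_ker_integrand(1)[OF T h(1) hs] .
  have v2: "integrable lborel (\<lambda>z. (h z * ker T hs z y)\<^sup>2)"
    and le: "(\<integral>z. (h z * ker T hs z y)\<^sup>2 \<partial>lborel) \<le> b\<^sup>2 * (\<integral>z. (ker T hs z y)\<^sup>2 \<partial>lborel)"
    using integrable_bounded_mult_square[of h lborel "\<lambda>z. ker T hs z y" b] Cons.IH h by auto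
  have "(\<integral>z. (ker T (h # hs) z y)\<^sup>2 \<partial>lborel) \<le> (2 * pi)\<^sup>2 * (\<integral>z. (h z * ker T hs z y)\<^sup>2 \<partial>lborel)"
    unfolding ker_Cons_eq_proj by (rule proj_L2[OF T v v2])
  also have "\<dots> \<le> (2 * pi)\<^sup>2 * (b\<^sup>2 * (2 * pi * T * ((2 * pi) ^ length hs * prod_list bs)\<^sup>2))"
    by (intro mult_left_mono order_trans[OF le]) (use Cons.IH in auto)
  also have "\<dots> = 2 * pi * T * ((2 * pi) ^ length (h # hs) * prod_list (b # bs))\<^sup>2"
    by (simp add: power_mult_distrib)
  finally show ?case using proj_L2(1)[OF T v v2] unfolding ker_Cons_eq_proj by blast
qed

text \<open>Cauchy-Schwarz pairs the first S with the rest of the chain. Each side contributes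
  sqrt(2 pi T), so the growth is linear in T whatever the number of symbols.\<close>

lemma ker_diagonal_le:
  assumes T: "T > 0" and "list_all2 bounded_integrable hs bs"
  shows "\<bar>ker T hs x x\<bar> \<le> T * (2 * pi) ^ length hs * prod_list bs"
proof (cases hs)
  case Nil
  then show ?thesis using T assms(2) by simp
next
  case (Cons h as)
  then obtain b cs where "bs = b # cs" "bounded_integrable h b" "list_all2 bounded_integrable as cs"
    using assms(2) by (auto simp: list_all2_Cons1)
  note Cons = Cons this
  have as: "\<forall>h\<in>set as. integrable lborel h" using Cons by (intro list_all2_bounded_integrable) auto
  have h: "integrable lborel h" "\<And>x. \<bar>h x\<bar> \<le> b" using Cons by auto
  have b: "0 \<le> b" using h(2)[of 0] by linarith
  have [measurable]: "h \<in> borel_measurable borel" using h by auto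
  note [measurable] = ker_measurable[OF as]
  let ?K = "(2 * pi) ^ length as * prod_list cs"
  have K: "0 \<le> ?K" using prod_list_bounds_nonneg Cons by simp
  have L2: "integrable lborel (\<lambda>z. (ker T as z x)\<^sup>2)" "(\<integral>z. (ker T as z x)\<^sup>2 \<partial>lborel) \<le> 2 * pi * T * ?K\<^sup>2"
    using ker_L2[OF T, of as cs x] Cons by auto
  have v2: "integrable lborel (\<lambda>z. (h z * ker T as z x)\<^sup>2)"
    and le: "(\<integral>z. (h z * ker T as z x)\<^sup>2 \<partial>lborel) \<le> b\<^sup>2 * (\<integral>z. (ker T as z x)\<^sup>2 \<partial>lborel)"
    using integrable_bounded_mult_square[of h lborel "\<lambda>z. ker T as z x" b] L2 h by auto
  have "\<bar>ker T hs x x\<bar> \<le> (\<integral>z. \<bar>sker T (x - z) * (h z * ker T as z x)\<bar> \<partial>lborel)"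
    using Cons by (simp add: mult.assoc)
  also have "\<dots> \<le> sqrt (2 * pi * T) * sqrt (\<integral>z. (h z * ker T as z x)\<^sup>2 \<partial>lborel)"
    using Cauchy_Schwarz_integral[of "\<lambda>z. sker T (x - z)" lborel "\<lambda>z. h z * ker T as z x"] v2
    by (simp add: integrable_sker_shift_square[OF T] integral_sker_square[OF T])
  also have "\<dots> \<le> sqrt (2 * pi * T) * sqrt (b\<^sup>2 * (2 * pi * T * ?K\<^sup>2))"
    by (intro mult_left_mono real_sqrt_le_mono order_trans[OF le]) (use T L2 in auto)
  also have "\<dots> = T * (2 * pi) ^ length hs * prod_list bs"
  proof -
    \<comment> \<open>The product of the two square roots is 2 pi T; its factor 2 pi raises the
      exponent from \<open>length as\<close> to \<open>length hs\<close>.\<close>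
    define q k where "q = 2 * pi * T" and "k = ?K"
    have "q \<ge> 0" "k \<ge> 0" using T K by (auto simp: q_def k_def)
    then have "sqrt (b\<^sup>2 * (q * k\<^sup>2)) = b * k * sqrt q" using b by (simp add: real_sqrt_mult)
    then have "sqrt q * sqrt (b\<^sup>2 * (q * k\<^sup>2)) = b * k * (sqrt q * sqrt q)" by (simp only: mult_ac)
    also have "\<dots> = b * k * q" using \<open>q \<ge> 0\<close> by simp
    also have "\<dots> = T * (2 * pi) ^ length hs * prod_list bs"
      unfolding Cons(1,2) q_def k_def by (simp only: list.size prod_list.Cons power_Suc mult_ac add_0_right add_Suc_right)
    finally show ?thesis unfolding q_def k_def .
  qed
  finally show ?thesis .
qed

section \<open>Modulus of continuity of translations in L^1\<close>

lemma integral_translation: "(\<integral>x. f (x + u) \<partial>lborel) = (\<integral>x. f x \<partial>lborel)" for f :: "real \<Rightarrow> real"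
  using lborel_integral_real_affine[of 1 f u] by (simp add: add.commute)

lemma integrable_translation: "integrable lborel f \<Longrightarrow> integrable lborel (\<lambda>x. f (x + u))" for f :: "real \<Rightarrow> real"
  using lborel_integrable_real_affine[of f 1 u] by (simp add: add.commute)

definition modulus_L1 :: "(real \<Rightarrow> real) \<Rightarrow> real \<Rightarrow> real" where
  "modulus_L1 h u = (\<integral>x. \<bar>h (x + u) - h x\<bar> \<partial>lborel)"

lemma modulus_L1_nonneg: "0 \<le> modulus_L1 h u"
  by (simp add: modulus_L1_def)

lemma modulus_L1_le:
  assumes h: "integrable lborel h" and k: "integrable lborel k"
  shows "modulus_L1 h u \<le> modulus_L1 k u + 2 * (\<integral>x. \<bar>h x - k x\<bar> \<partial>lborel)"
proof -
  note t = integrable_translation[of _ u]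
  have "modulus_L1 h u \<le> (\<integral>x. \<bar>h (x + u) - k (x + u)\<bar> + \<bar>k (x + u) - k x\<bar> + \<bar>h x - k x\<bar> \<partial>lborel)"
    unfolding modulus_L1_def by (rule integral_mono) (use h k t[OF h] t[OF k] in auto)
  also have "\<dots> = (\<integral>x. \<bar>h (x + u) - k (x + u)\<bar> \<partial>lborel) + modulus_L1 k u + (\<integral>x. \<bar>h x - k x\<bar> \<partial>lborel)"
    unfolding modulus_L1_def using h k t[OF h] t[OF k] by simp
  also have "(\<integral>x. \<bar>h (x + u) - k (x + u)\<bar> \<partial>lborel) = (\<integral>x. \<bar>h x - k x\<bar> \<partial>lborel)"
    by (rule integral_translation)
  finally show ?thesis by simp
qed

text \<open>The functions with vanishing modulus form an L^1-closed class. This is used twice: from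
  open sets to Borel sets, and in the limit case of the induction over integrable functions.\<close>

lemma modulus_L1_tendsto_approx:
  assumes h: "integrable lborel h" and X: "X \<longlonglongrightarrow> 0"
    and a: "\<And>e. e > 0 \<Longrightarrow> \<exists>k. integrable lborel k \<and> (\<integral>x. \<bar>h x - k x\<bar> \<partial>lborel) < e \<and> (\<lambda>n. modulus_L1 k (X n)) \<longlonglongrightarrow> 0"
  shows "(\<lambda>n. modulus_L1 h (X n)) \<longlonglongrightarrow> 0"
proof (rule LIMSEQ_I)
  fix e :: real assume "e > 0"
  then obtain k where k: "integrable lborel k" "(\<integral>x. \<bar>h x - k x\<bar> \<partial>lborel) < e / 4" "(\<lambda>n. modulus_L1 k (X n)) \<longlonglongrightarrow> 0"
    using a[of "e / 4"] by auto
  from LIMSEQ_D[OF k(3), of "e / 2"] \<open>e > 0\<close> obtain n0 where n0: "\<And>n. n \<ge> n0 \<Longrightarrow> modulus_L1 k (X n) < e / 2"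
    using modulus_L1_nonneg[of k] by auto
  have "norm (modulus_L1 h (X n) - 0) < e" if "n \<ge> n0" for n
    using modulus_L1_le[OF h k(1), of "X n"] n0[OF that] k(2) modulus_L1_nonneg[of h "X n"] by simp
  then show "\<exists>no. \<forall>n\<ge>no. norm (modulus_L1 h (X n) - 0) < e" by blast
qed

text \<open>The indicator of an open set is lower semicontinuous, so the positive part of the difference
  tends to \<open>0\<close>; the negative part has the same integral.\<close>
lemma modulus_L1_open:
  assumes U: "open U" "emeasure lborel U < \<infinity>" and X: "X \<longlonglongrightarrow> 0"
  shows "(\<lambda>n. modulus_L1 (indicator U) (X n)) \<longlonglongrightarrow> 0"
proof -
  let ?I = "indicator U :: real \<Rightarrow> real"
  have [measurable]: "U \<in> sets borel" using U by auto
  have i: "integrable lborel ?I" using U by (simp add: integrable_indicator_iff)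
  note t = integrable_translation[OF i]
  define d where "d n x = max 0 (?I x - ?I (x + X n))" for n x
  have dm [measurable]: "d n \<in> borel_measurable borel" for n
    unfolding d_def[abs_def] by measurable
  have m: "modulus_L1 ?I (X n) = 2 * (\<integral>x. d n x \<partial>lborel)" for n
  proof -
    have "\<bar>?I (x + X n) - ?I x\<bar> = 2 * d n x + (?I (x + X n) - ?I x)" for x by (auto simp: d_def max_def abs_if)
    then have "modulus_L1 ?I (X n) = (\<integral>x. 2 * d n x + (?I (x + X n) - ?I x) \<partial>lborel)"
      by (simp add: modulus_L1_def)
    also have "\<dots> = 2 * (\<integral>x. d n x \<partial>lborel)"
      using i t[of "X n"] integral_translation[of ?I "X n"] unfolding d_def
      by (subst Bochner_Integration.integral_add) auto
    finally show ?thesis .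
  qed
  have "(\<lambda>n. \<integral>x. d n x \<partial>lborel) \<longlonglongrightarrow> integral\<^sup>L lborel (\<lambda>x::real. 0 :: real)"
  proof (rule integral_dominated_convergence[where w = ?I and s = d and f = "\<lambda>_. 0"])
    show "AE x in lborel. (\<lambda>n. d n x) \<longlonglongrightarrow> 0"
    proof (rule AE_I2)
      fix x :: real
      show "(\<lambda>n. d n x) \<longlonglongrightarrow> 0"
      proof (cases "x \<in> U")
        case True
        have "(\<lambda>n. x + X n) \<longlonglongrightarrow> x + 0" using X by (intro tendsto_intros)
        then have "eventually (\<lambda>n. x + X n \<in> U) sequentially"
          using topological_tendstoD[of "\<lambda>n. x + X n" "x + 0" sequentially U] U True by simp
        then have "eventually (\<lambda>n. d n x = 0) sequentially"
          by eventually_elim (use True in \<open>auto simp: d_def\<close>)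
        then show ?thesis by (rule tendsto_eventually)
      next
        case False
        then have "d n x = 0" for n by (auto simp: d_def indicator_def)
        then show ?thesis by simp
      qed
    qed
    show "AE x in lborel. norm (d n x) \<le> ?I x" for n
      by (auto simp: d_def indicator_def)
  qed (use i in auto)
  then show ?thesis unfolding m using tendsto_mult_right_zero[of "\<lambda>n. \<integral>x. d n x \<partial>lborel" sequentially 2] by simp
qed

text \<open>Continuity of translation in L^1. Indicators of Borel sets are approximated from outside
  by open sets, using outer regularity; scalar multiples, sums and dominated limits inherit the
  property.\<close>

lemma modulus_L1_tendsto_0:
  assumes "integrable lborel h" and X: "X \<longlonglongrightarrow> 0"
  shows "(\<lambda>n. modulus_L1 h (X n)) \<longlonglongrightarrow> 0"
  using assms(1)
proof (induction rule: integrable_induct)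
  case (base A c)
  have [measurable]: "A \<in> sets borel" using base by simp
  have iA: "integrable lborel (indicator A :: real \<Rightarrow> real)" using base by (simp add: integrable_indicator_iff)
  have "(\<lambda>n. modulus_L1 (indicator A) (X n)) \<longlonglongrightarrow> 0"
  proof (rule modulus_L1_tendsto_approx[OF iA X])
    fix e :: real assume e: "e > 0"
    obtain U where U: "open U" "A \<subseteq> U" "emeasure lborel (U - A) < e"
      using outer_regular_lborel[of A e] e by auto
    have [measurable]: "U \<in> sets borel" using U by auto
    have "emeasure lborel U = emeasure lborel (A \<union> (U - A))" using U by (simp add: Un_absorb1)
    also have "\<dots> \<le> emeasure lborel A + emeasure lborel (U - A)" by (rule emeasure_subadditive) auto
    also have "\<dots> < \<infinity>" using base less_trans[OF U(3) ennreal_less_top] by simp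
    finally have fU: "emeasure lborel U < \<infinity>" .
    have iU: "integrable lborel (indicator U :: real \<Rightarrow> real)" using fU by (simp add: integrable_indicator_iff)
    have "\<bar>indicator A x - indicator U x\<bar> = (indicator (U - A) x :: real)" for x
      using U(2) by (auto simp: indicator_def)
    then have "(\<integral>x. \<bar>indicator A x - indicator U x :: real\<bar> \<partial>lborel) = measure lborel (U - A)" by simp
    also have "\<dots> < e"
    proof -
      have "emeasure lborel (U - A) = ennreal (measure lborel (U - A))"
        by (rule emeasure_eq_ennreal_measure) (use U(3) in auto)
      then show ?thesis using U(3) e by (simp add: ennreal_less_iff)
    qed
    finally show "\<exists>k. integrable lborel k \<and> (\<integral>x. \<bar>indicator A x - k x\<bar> \<partial>lborel) < e \<and> (\<lambda>n. modulus_L1 k (X n)) \<longlonglongrightarrow> 0"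
      using iU modulus_L1_open[OF U(1) fU X] by blast
  qed
  moreover have "modulus_L1 (\<lambda>x. indicator A x *\<^sub>R c) u = \<bar>c\<bar> * modulus_L1 (indicator A) u" for u
  proof -
    have "\<bar>indicator A (x + u) *\<^sub>R c - indicator A x *\<^sub>R c\<bar> = \<bar>c\<bar> * \<bar>indicator A (x + u) - indicator A x\<bar>" for x
      unfolding abs_mult[symmetric] by (simp add: algebra_simps)
    then show ?thesis unfolding modulus_L1_def by (simp only: integral_mult_right_zero)
  qed
  ultimately show ?case using tendsto_mult_right_zero by simp
next
  case (add f g)
  have le: "modulus_L1 (\<lambda>x. f x + g x) u \<le> modulus_L1 f u + modulus_L1 g u" for u
  proof -
    have i: "integrable lborel (\<lambda>x. \<bar>k (x + u) - k x\<bar>)" if "integrable lborel k" for k :: "real \<Rightarrow> real"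
      using that integrable_translation[OF that] by auto
    have s: "integrable lborel (\<lambda>x. f x + g x)" using add.hyps by simp
    have "modulus_L1 (\<lambda>x. f x + g x) u \<le> (\<integral>x. \<bar>f (x + u) - f x\<bar> + \<bar>g (x + u) - g x\<bar> \<partial>lborel)"
      unfolding modulus_L1_def
      by (rule integral_mono[OF i[OF s] Bochner_Integration.integrable_add[OF i[OF add.hyps(1)] i[OF add.hyps(2)]]]) simp
    also have "\<dots> = modulus_L1 f u + modulus_L1 g u"
      unfolding modulus_L1_def by (rule Bochner_Integration.integral_add[OF i[OF add.hyps(1)] i[OF add.hyps(2)]])
    finally show ?thesis .
  qed
  have lim: "(\<lambda>n. modulus_L1 f (X n) + modulus_L1 g (X n)) \<longlonglongrightarrow> 0"
    using tendsto_add[OF add.IH] by simp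
  show ?case
    by (rule tendsto_sandwich[OF _ _ tendsto_const lim]) (use le modulus_L1_nonneg in auto)
next
  case (lim f s)
  show ?case
  proof (rule modulus_L1_tendsto_approx[OF lim.hyps(4) X])
    fix e :: real assume e: "e > 0"
    \<comment> \<open>The approximants satisfy |s i x| \<le> 2 |f x|, which explains the majorant 3
      |f x|.\<close>
    have "(\<lambda>i. \<integral>x. \<bar>f x - s i x\<bar> \<partial>lborel) \<longlonglongrightarrow> integral\<^sup>L lborel (\<lambda>x::real. 0 :: real)"
    proof (rule integral_dominated_convergence[where w = "\<lambda>x. 3 * \<bar>f x\<bar>"])
      show "AE x in lborel. (\<lambda>i. \<bar>f x - s i x\<bar>) \<longlonglongrightarrow> 0"
      proof (rule AE_I2)
        fix x :: real
        have "(\<lambda>i. s i x) \<longlonglongrightarrow> f x" using lim.hyps(2) by simp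
        then have "(\<lambda>i. \<bar>f x - s i x\<bar>) \<longlonglongrightarrow> \<bar>f x - f x\<bar>" by (intro tendsto_intros)
        then show "(\<lambda>i. \<bar>f x - s i x\<bar>) \<longlonglongrightarrow> 0" by simp
      qed
      show "AE x in lborel. norm \<bar>f x - s i x\<bar> \<le> 3 * \<bar>f x\<bar>" for i
      proof (rule AE_I2)
        fix x show "norm \<bar>f x - s i x\<bar> \<le> 3 * \<bar>f x\<bar>" using lim.hyps(3)[of x i] by simp
      qed
    qed (use lim.hyps(1,4) in auto)
    then have "eventually (\<lambda>i. (\<integral>x. \<bar>f x - s i x\<bar> \<partial>lborel) < e) sequentially"
      using e by (auto dest: order_tendstoD)
    then obtain i where "(\<integral>x. \<bar>f x - s i x\<bar> \<partial>lborel) < e" by (auto simp: eventually_sequentially)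
    then show "\<exists>k. integrable lborel k \<and> (\<integral>x. \<bar>f x - k x\<bar> \<partial>lborel) < e \<and> (\<lambda>n. modulus_L1 k (X n)) \<longlonglongrightarrow> 0"
      using lim.hyps(1) lim.IH by blast
  qed
qed

section \<open>The limit for bounded symbols\<close>

lemma modulus_L1_measurable:
  assumes "integrable lborel h"
  shows "modulus_L1 h \<in> borel_measurable borel"
proof -
  have [measurable]: "h \<in> borel_measurable borel" using assms by auto
  show ?thesis unfolding modulus_L1_def[abs_def] by measurable
qed

lemma modulus_L1_bound:
  assumes h: "integrable lborel h"
  shows "modulus_L1 h u \<le> 2 * (\<integral>x. \<bar>h x\<bar> \<partial>lborel)"
  using modulus_L1_le[OF h, of "\<lambda>_. 0" u] by (simp add: modulus_L1_def)

lemma modulus_L1_scaled_tendsto_0: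
  assumes h: "integrable lborel h"
  shows "((\<lambda>T. modulus_L1 h (v / T)) \<longlongrightarrow> 0) at_top"
proof -
  have z: "modulus_L1 h 0 = 0" by (simp add: modulus_L1_def)
  have "isCont (modulus_L1 h) 0"
    unfolding continuous_at_sequentially using modulus_L1_tendsto_0[OF h] by (simp add: z comp_def)
  moreover have "((\<lambda>T. v / T) \<longlongrightarrow> 0) at_top"
    by (rule real_tendsto_divide_at_top[OF tendsto_const filterlim_ident])
  ultimately show ?thesis using isCont_tendsto_compose[of 0 "modulus_L1 h" "\<lambda>T. v / T" at_top] z by simp
qed

text \<open>The squares of S divided by T form an approximate identity of mass 2 pi. Substituting u
  = v/T moves the dependence on T into the modulus alone, where dominated convergence
  applies.\<close>

lemma smoothed_modulus_tendsto_0: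
  assumes h: "integrable lborel h"
  shows "((\<lambda>T. (\<integral>u. modulus_L1 h u * (sker T u)\<^sup>2 \<partial>lborel) / T) \<longlongrightarrow> 0) at_top"
proof -
  note [measurable] = modulus_L1_measurable[OF h]
  have "((\<lambda>T. \<integral>v. modulus_L1 h (v / T) * (sker 1 v)\<^sup>2 \<partial>lborel) \<longlongrightarrow> integral\<^sup>L lborel (\<lambda>v::real. 0::real)) at_top"
  proof (rule integral_dominated_convergence_at_top[where w = "\<lambda>v. 2 * (\<integral>x. \<bar>h x\<bar> \<partial>lborel) * (sker 1 v)\<^sup>2"])
    show "AE v in lborel. ((\<lambda>T. modulus_L1 h (v / T) * (sker 1 v)\<^sup>2) \<longlongrightarrow> 0) at_top"
      by (intro AE_I2 tendsto_mult_left_zero modulus_L1_scaled_tendsto_0 h)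
    show "\<forall>\<^sub>F T in at_top. AE v in lborel. norm (modulus_L1 h (v / T) * (sker 1 v)\<^sup>2) \<le> 2 * (\<integral>x. \<bar>h x\<bar> \<partial>lborel) * (sker 1 v)\<^sup>2"
      by (intro always_eventually allI AE_I2)
        (auto simp: abs_mult modulus_L1_nonneg intro!: mult_right_mono modulus_L1_bound[OF h])
  qed (auto intro!: integrable_mult_right integrable_sker_square)
  then have "((\<lambda>T. \<integral>v. modulus_L1 h (v / T) * (sker 1 v)\<^sup>2 \<partial>lborel) \<longlongrightarrow> 0) at_top" by simp
  moreover have "\<forall>\<^sub>F T in at_top. (\<integral>v. modulus_L1 h (v / T) * (sker 1 v)\<^sup>2 \<partial>lborel) = (\<integral>u. modulus_L1 h u * (sker T u)\<^sup>2 \<partial>lborel) / T"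
    using eventually_gt_at_top[of 0]
  proof eventually_elim
    case (elim T)
    have "(\<integral>u. modulus_L1 h u * (sker T u)\<^sup>2 \<partial>lborel) = (1 / T) * (\<integral>v. modulus_L1 h (v / T) * (sker T (v / T))\<^sup>2 \<partial>lborel)"
      using elim lborel_integral_real_affine[of "1 / T" "\<lambda>u. modulus_L1 h u * (sker T u)\<^sup>2" 0] by simp
    also have "(\<lambda>v. modulus_L1 h (v / T) * (sker T (v / T))\<^sup>2) = (\<lambda>v. T\<^sup>2 * (modulus_L1 h (v / T) * (sker 1 v)\<^sup>2))"
      using elim sker_scale[of T "v / T" for v] by (auto simp: power_mult_distrib)
    finally show ?case using elim by (simp add: power2_eq_square)
  qed
  ultimately show ?thesis by (rule Lim_transform_eventually)
qed

text \<open>Replacing h2(z) by h2(x) would let two factors S collapse to 2 pi S. The error carries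
  the commutator kernel S(x - z) (h2(z) - h2(x)); Cauchy-Schwarz in z and then in x separates the
  rest of the chain, the first symbol and the Hilbert-Schmidt norm of the commutator.\<close>

lemma cyc_merge_le:
  assumes T: "T > 0" and h1: "bounded_integrable h1 b1" and h2: "bounded_integrable h2 b2"
    and hs: "list_all2 bounded_integrable hs bs"
  shows "\<bar>cyc T (h1 # h2 # hs) - 2 * pi * cyc T ((\<lambda>x. h1 x * h2 x) # hs)\<bar> \<le>
    sqrt (2 * pi * T * ((2 * pi) ^ length hs * prod_list bs)\<^sup>2) * (sqrt (\<integral>x. (h1 x)\<^sup>2 \<partial>lborel) *
      sqrt (2 * b2 * (\<integral>u. modulus_L1 h2 u * (sker T u)\<^sup>2 \<partial>lborel)))"
proof -
  let ?E = "2 * pi * T * ((2 * pi) ^ length hs * prod_list bs)\<^sup>2"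
  have ihs: "\<forall>h\<in>set hs. integrable lborel h" using hs by (rule list_all2_bounded_integrable)
  have i1: "integrable lborel h1" and i2: "integrable lborel h2" and bd1: "\<And>x. \<bar>h1 x\<bar> \<le> b1" and bd2: "\<And>x. \<bar>h2 x\<bar> \<le> b2"
    using h1 h2 by auto
  have [measurable]: "h1 \<in> borel_measurable borel" "h2 \<in> borel_measurable borel" using h1 h2 by auto
  note [measurable] = ker_measurable[OF ihs] modulus_L1_measurable[OF i2]
  have b2: "0 \<le> b2" using bd2[of 0] by linarith
  \<comment> \<open>Boundedness trades the squared increment for the plain one, so that the L^1
    modulus suffices.\<close>
  have d2: "(h2 (x + u) - h2 x)\<^sup>2 \<le> 2 * b2 * \<bar>h2 (x + u) - h2 x\<bar>" for x u
  proof -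
    have "\<bar>h2 (x + u) - h2 x\<bar> \<le> 2 * b2" using bd2[of x] bd2[of "x + u"] by linarith
    then have "\<bar>h2 (x + u) - h2 x\<bar> * \<bar>h2 (x + u) - h2 x\<bar> \<le> 2 * b2 * \<bar>h2 (x + u) - h2 x\<bar>"
      by (rule mult_right_mono) simp
    then show ?thesis by (simp add: power2_eq_square)
  qed
  have iab: "integrable lborel (\<lambda>x. 2 * b2 * \<bar>h2 (x + u) - h2 x\<bar>)" for u
    using i2 integrable_translation[OF i2] by auto
  have iG: "integrable lborel (\<lambda>x. (h2 (x + u) - h2 x)\<^sup>2)" for u
    by (rule Bochner_Integration.integrable_bound[OF iab[of u]]) (use d2 in \<open>auto intro!: AE_I2 intro: order_trans[OF _ abs_ge_self]\<close>)
  have G_le: "(\<integral>x. (h2 (x + u) - h2 x)\<^sup>2 \<partial>lborel) \<le> 2 * b2 * modulus_L1 h2 u" for u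
    using integral_mono[OF iG iab d2, of u] by (simp add: modulus_L1_def)
  have C: "(\<integral>x. \<bar>(h2 (x + u) - h2 x)\<^sup>2\<bar> \<partial>lborel) \<le> 2 * b2 * (2 * (\<integral>x. \<bar>h2 x\<bar> \<partial>lborel))" for u
    using order_trans[OF G_le[of u] mult_left_mono[OF modulus_L1_bound[OF i2, of u], of "2 * b2"]] b2 by simp
  \<comment> \<open>Squared L^2 norm of one row of the commutator kernel; its integral over
    \<open>x\<close> is the squared Hilbert-Schmidt norm.\<close>
  define A where "A x = (\<integral>z. (sker T (x - z) * (h2 z - h2 x))\<^sup>2 \<partial>lborel)" for x
  have A: "A x = (\<integral>u. (h2 (x + u) - h2 x)\<^sup>2 * (sker T u)\<^sup>2 \<partial>lborel)" for x
    unfolding A_def using integral_translation[of "\<lambda>z. (sker T (x - z) * (h2 z - h2 x))\<^sup>2" x]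
    by (simp add: power_mult_distrib mult.commute add.commute)
  have mG: "(\<lambda>(x, u). (h2 (x + u) - h2 x)\<^sup>2) \<in> borel_measurable (borel \<Otimes>\<^sub>M borel)" by measurable
  note F = Fubini_kernel[OF integrable_sker_square[OF T] mG iG C]
  have iA: "integrable lborel A"
    using lborel_pair.integrable_fst[OF F(1)] unfolding A[symmetric] .
  have A0: "0 \<le> A x" for x unfolding A_def by simp
  have intA: "(\<integral>x. A x \<partial>lborel) \<le> 2 * b2 * (\<integral>u. modulus_L1 h2 u * (sker T u)\<^sup>2 \<partial>lborel)"
  proof -
    have i: "integrable lborel (\<lambda>u. (2 * b2 * modulus_L1 h2 u) * (sker T u)\<^sup>2)"
      by (rule integrable_mult_bounded[OF integrable_sker_square[OF T], where B = "2 * b2 * (2 * (\<integral>x. \<bar>h2 x\<bar> \<partial>lborel))"])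
        (use b2 mult_left_mono[OF modulus_L1_bound[OF i2], of "2 * b2"] in \<open>auto simp: abs_mult modulus_L1_nonneg\<close>)
    have "(\<integral>x. A x \<partial>lborel) = (\<integral>u. (\<integral>x. (h2 (x + u) - h2 x)\<^sup>2 \<partial>lborel) * (sker T u)\<^sup>2 \<partial>lborel)"
      using F(2) unfolding A[symmetric] .
    also have "\<dots> \<le> (\<integral>u. (2 * b2 * modulus_L1 h2 u) * (sker T u)\<^sup>2 \<partial>lborel)"
    proof (rule integral_mono[OF _ i])
      show "integrable lborel (\<lambda>u. (\<integral>x. (h2 (x + u) - h2 x)\<^sup>2 \<partial>lborel) * (sker T u)\<^sup>2)"
        by (rule integrable_mult_bounded[OF integrable_sker_square[OF T]]) (use C in auto)
      show "(\<integral>x. (h2 (x + u) - h2 x)\<^sup>2 \<partial>lborel) * (sker T u)\<^sup>2 \<le> 2 * b2 * modulus_L1 h2 u * (sker T u)\<^sup>2" for u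
        by (rule mult_right_mono[OF G_le]) simp
    qed
    finally show ?thesis by (simp add: mult.assoc)
  qed
  have isq: "integrable lborel (\<lambda>z. (sker T (x - z) * (h2 z - h2 x))\<^sup>2)" for x
  proof -
    have "\<bar>(h2 z - h2 x)\<^sup>2\<bar> \<le> (2 * b2)\<^sup>2" for z
    proof -
      have "\<bar>h2 z - h2 x\<bar> \<le> 2 * b2" using bd2[of x] bd2[of z] by linarith
      from power_mono[OF this, of 2] show ?thesis by simp
    qed
    from integrable_mult_bounded[OF integrable_sker_shift_square(1)[OF T, of x], of "\<lambda>z. (h2 z - h2 x)\<^sup>2", OF _ this]
    show ?thesis by (simp add: power_mult_distrib mult.commute)
  qed
  let ?R = "\<lambda>x. (\<integral>z. (sker T (x - z) * (h2 z - h2 x)) * ker T hs z x \<partial>lborel)"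
  have L2: "integrable lborel (\<lambda>z. (ker T hs z x)\<^sup>2)" "(\<integral>z. (ker T hs z x)\<^sup>2 \<partial>lborel) \<le> ?E" for x
    using ker_L2[OF T hs, of x] by auto
  have R: "\<bar>?R x\<bar> \<le> sqrt (A x) * sqrt ?E" for x
  proof -
    have "\<bar>?R x\<bar> \<le> (\<integral>z. \<bar>(sker T (x - z) * (h2 z - h2 x)) * ker T hs z x\<bar> \<partial>lborel)"
      by (rule integral_abs_bound)
    also have "\<dots> \<le> sqrt (A x) * sqrt (\<integral>z. (ker T hs z x)\<^sup>2 \<partial>lborel)"
      unfolding A_def by (rule Cauchy_Schwarz_integral) (use L2 isq in auto)
    also have "\<dots> \<le> sqrt (A x) * sqrt ?E" by (intro mult_left_mono real_sqrt_le_mono L2) (use A0 in auto)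
    finally show ?thesis .
  qed
  \<comment> \<open>The subtracted term is where the reproducing property merges S S into 2 pi
    S.\<close>
  have Req: "?R x = ker T (h2 # hs) x x - h2 x * (2 * pi * ker T hs x x)" for x
  proof -
    have "?R x = (\<integral>z. sker T (x - z) * h2 z * ker T hs z x - h2 x * (sker T (x - z) * ker T hs z x) \<partial>lborel)"
      by (intro Bochner_Integration.integral_cong) (auto simp: algebra_simps)
    also have "\<dots> = ker T (h2 # hs) x x - h2 x * (2 * pi * ker T hs x x)"
      using integrable_ker_integrand(2)[OF T i2 ihs, of x x] ker_reproducing[OF T ihs, of x x]
      by (subst Bochner_Integration.integral_diff) auto
    finally show ?thesis .
  qed
  have i12: "integrable lborel (\<lambda>x. h1 x * h2 x)"
    by (rule integrable_mult_bounded[OF i2 _ bd1]) measurable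
  have ic1: "integrable lborel (\<lambda>x. h1 x * ker T (h2 # hs) x x)"
    using integrable_ker_integrand(3)[OF T i1, of "h2 # hs"] ihs i2 by simp
  have ic2: "integrable lborel (\<lambda>x. h1 x * h2 x * ker T hs x x)"
    using integrable_ker_integrand(3)[OF T i12 ihs] .
  have "cyc T (h1 # h2 # hs) - 2 * pi * cyc T ((\<lambda>x. h1 x * h2 x) # hs) =
     (\<integral>x. h1 x * ker T (h2 # hs) x x - 2 * pi * (h1 x * h2 x * ker T hs x x) \<partial>lborel)"
    using ic1 ic2 by (subst Bochner_Integration.integral_diff) (auto simp del: ker.simps)
  also have "\<dots> = (\<integral>x. h1 x * ?R x \<partial>lborel)"
    unfolding Req by (intro Bochner_Integration.integral_cong) (auto simp: algebra_simps simp del: ker.simps)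
  finally have eq: "cyc T (h1 # h2 # hs) - 2 * pi * cyc T ((\<lambda>x. h1 x * h2 x) # hs) = (\<integral>x. h1 x * ?R x \<partial>lborel)" .
  have i1sq: "integrable lborel (\<lambda>x. (h1 x)\<^sup>2)"
    using integrable_mult_bounded[OF i1 _ bd1] by (simp add: power2_eq_square)
  have mA: "A \<in> borel_measurable borel" using iA by auto
  have iAs: "integrable lborel (\<lambda>x. (sqrt (A x))\<^sup>2)" using iA A0 by simp
  note [measurable] = mA
  have "\<bar>\<integral>x. h1 x * ?R x \<partial>lborel\<bar> \<le> (\<integral>x. \<bar>h1 x * ?R x\<bar> \<partial>lborel)" by (rule integral_abs_bound)
  also have "\<dots> \<le> (\<integral>x. sqrt ?E * \<bar>h1 x * sqrt (A x)\<bar> \<partial>lborel)"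
  proof (rule integral_mono)
    show "integrable lborel (\<lambda>x. \<bar>h1 x * ?R x\<bar>)"
    proof (rule integrable_abs)
      have "h1 x * ?R x = h1 x * ker T (h2 # hs) x x - 2 * pi * (h1 x * h2 x * ker T hs x x)" for x
        unfolding Req by (simp add: algebra_simps del: ker.simps)
      then show "integrable lborel (\<lambda>x. h1 x * ?R x)" using ic1 ic2 by (simp del: ker.simps)
    qed
    show "integrable lborel (\<lambda>x. sqrt ?E * \<bar>h1 x * sqrt (A x)\<bar>)"
      by (intro integrable_mult_right integrable_abs integrable_square_imp_integrable_mult i1sq iAs) measurable
    show "\<bar>h1 x * ?R x\<bar> \<le> sqrt ?E * \<bar>h1 x * sqrt (A x)\<bar>" for x
      using mult_left_mono[OF R[of x], of "\<bar>h1 x\<bar>"] A0[of x] by (simp add: abs_mult mult_ac)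
  qed
  also have "\<dots> = sqrt ?E * (\<integral>x. \<bar>h1 x * sqrt (A x)\<bar> \<partial>lborel)" by simp
  also have "\<dots> \<le> sqrt ?E * (sqrt (\<integral>x. (h1 x)\<^sup>2 \<partial>lborel) * sqrt (\<integral>x. (sqrt (A x))\<^sup>2 \<partial>lborel))"
    by (intro mult_left_mono Cauchy_Schwarz_integral i1sq iAs) (use T in auto)
  also have "(\<integral>x. (sqrt (A x))\<^sup>2 \<partial>lborel) = (\<integral>x. A x \<partial>lborel)" using A0 by simp
  also have "sqrt ?E * (sqrt (\<integral>x. (h1 x)\<^sup>2 \<partial>lborel) * sqrt (\<integral>x. A x \<partial>lborel)) \<le>
     sqrt ?E * (sqrt (\<integral>x. (h1 x)\<^sup>2 \<partial>lborel) * sqrt (2 * b2 * (\<integral>u. modulus_L1 h2 u * (sker T u)\<^sup>2 \<partial>lborel)))"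
    by (intro mult_left_mono real_sqrt_le_mono intA) (use T in auto)
  finally show ?thesis unfolding eq .
qed

lemma cyc_merge_tendsto_0:
  assumes h1: "bounded_integrable h1 b1" and h2: "bounded_integrable h2 b2"
    and hs: "list_all2 bounded_integrable hs bs"
  shows "((\<lambda>T. cyc T (h1 # h2 # hs) / T - 2 * pi * (cyc T ((\<lambda>x. h1 x * h2 x) # hs) / T)) \<longlongrightarrow> 0) at_top"
proof -
  let ?K = "(2 * pi) ^ length hs * prod_list bs"
  let ?M = "\<lambda>T. (\<integral>u. modulus_L1 h2 u * (sker T u)\<^sup>2 \<partial>lborel)"
  let ?c = "sqrt (2 * pi * ?K\<^sup>2) * sqrt (\<integral>x. (h1 x)\<^sup>2 \<partial>lborel)"
  have "((\<lambda>T. ?c * sqrt (2 * b2 * (?M T / T))) \<longlongrightarrow> ?c * sqrt (2 * b2 * 0)) at_top"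
    using smoothed_modulus_tendsto_0[of h2] h2 by (intro tendsto_intros) auto
  then have lim: "((\<lambda>T. ?c * sqrt (2 * b2 * (?M T / T))) \<longlongrightarrow> 0) at_top" by simp
  have "\<forall>\<^sub>F T in at_top. norm (cyc T (h1 # h2 # hs) / T - 2 * pi * (cyc T ((\<lambda>x. h1 x * h2 x) # hs) / T)) \<le> ?c * sqrt (2 * b2 * (?M T / T))"
    using eventually_gt_at_top[of 0]
  proof eventually_elim
    case (elim T)
    have "norm (cyc T (h1 # h2 # hs) / T - 2 * pi * (cyc T ((\<lambda>x. h1 x * h2 x) # hs) / T)) =
      \<bar>cyc T (h1 # h2 # hs) - 2 * pi * cyc T ((\<lambda>x. h1 x * h2 x) # hs)\<bar> / T"
      using elim by (simp del: cyc.simps add: diff_divide_distrib[symmetric])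
    also have "\<dots> \<le> (sqrt (2 * pi * T * ?K\<^sup>2) * (sqrt (\<integral>x. (h1 x)\<^sup>2 \<partial>lborel) * sqrt (2 * b2 * ?M T))) / T"
      by (rule divide_right_mono[OF cyc_merge_le[OF elim assms]]) (use elim in simp)
    also have "\<dots> = ?c * sqrt (2 * b2 * (?M T / T))"
    proof -
      \<comment> \<open>Half of the division by T compensates the growth of the chain norm; the
        other half normalizes the modulus integral, which is o(T).\<close>
      define S where "S = sqrt (2 * b2 * ?M T)"
      have 1: "sqrt (2 * pi * T * ?K\<^sup>2) = sqrt (2 * pi * ?K\<^sup>2) * sqrt T"
        unfolding real_sqrt_mult[symmetric] by (simp add: mult_ac)
      have 2: "sqrt (2 * b2 * (?M T / T)) = S / sqrt T" unfolding S_def real_sqrt_divide[symmetric] by simp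
      have 3: "sqrt T / T = 1 / sqrt T" using elim by (simp add: real_div_sqrt field_simps)
      show ?thesis unfolding 1 2 S_def[symmetric] using 3 elim by (simp add: divide_simps mult_ac)
    qed
    finally show ?case .
  qed
  from Lim_null_comparison[OF this lim] show ?thesis .
qed

text \<open>Each merge shortens the list by one and contributes 2 pi; for a single symbol the
  quotient is exactly its integral. The head and its bound vary in the induction because merging
  multiplies both.\<close>

lemma cyc_bounded_limit:
  assumes "bounded_integrable h b" and "list_all2 bounded_integrable hs bs"
  shows "((\<lambda>T. cyc T (h # hs) / T) \<longlongrightarrow> (2 * pi) ^ length hs * (\<integral>x. h x * (\<Prod>k\<leftarrow>hs. k x) \<partial>lborel)) at_top"
  using assms(2,1)
proof (induction arbitrary: h b rule: list_all2_induct)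
  case Nil
  have "\<forall>\<^sub>F T in at_top. (\<integral>x. h x \<partial>lborel) = cyc T [h] / T"
    using eventually_gt_at_top[of 0] by eventually_elim simp
  then show ?case by (simp add: tendsto_eventually eq_commute eventually_mono)
next
  case (Cons k hs c bs)
  have h12: "bounded_integrable (\<lambda>x. h x * k x) (b * c)"
  proof
    have [measurable]: "h \<in> borel_measurable borel" using Cons.prems by auto
    show "integrable lborel (\<lambda>x. h x * k x)"
      by (rule integrable_mult_bounded[where B = b]) (use Cons in auto)
    show "\<forall>x. \<bar>h x * k x\<bar> \<le> b * c"
      unfolding abs_mult using Cons.prems Cons(1) by (intro allI mult_mono) (auto intro: order_trans[OF abs_ge_zero])
  qed
  have "((\<lambda>T. (cyc T (h # k # hs) / T - 2 * pi * (cyc T ((\<lambda>x. h x * k x) # hs) / T)) +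
      2 * pi * (cyc T ((\<lambda>x. h x * k x) # hs) / T)) \<longlongrightarrow>
      0 + 2 * pi * ((2 * pi) ^ length hs * (\<integral>x. h x * k x * (\<Prod>k\<leftarrow>hs. k x) \<partial>lborel))) at_top"
    by (intro tendsto_add tendsto_mult tendsto_const cyc_merge_tendsto_0[OF Cons.prems Cons.hyps] Cons.IH[OF h12])
  then show ?case by (simp add: mult.assoc del: cyc.simps)
qed

section \<open>The operator trace\<close>

lemma cis_measurable [measurable]: "cis \<in> borel_measurable borel"
  by (intro borel_measurable_continuous_onI continuous_on_cis continuous_on_id)

text \<open>The phase appears because the window [0, T] is not centred at 0. In a chain of operators
  the phases telescope.\<close>

lemma integral_cis_interval:
  assumes T: "T > 0"
  shows "(\<integral>s. indicator {0..T} s *\<^sub>R cis (\<theta> * s) \<partial>lborel) = cis (\<theta> * T / 2) * of_real (sker T \<theta>)"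
proof (cases "\<theta> = 0")
  case True
  have "(\<integral>s. indicator {0..T} s *\<^sub>R (1::complex) \<partial>lborel) = of_real T"
    using T by (simp add: scaleR_conv_of_real)
  then show ?thesis using True by simp
next
  case False
  define F where "F s = - \<i> * cis (\<theta> * s) / of_real \<theta>" for s
  have "(\<integral>s. indicator {0..T} s *\<^sub>R cis (\<theta> * s) \<partial>lborel) = F T - F 0"
  proof (rule integral_FTC_Icc)
    show "(F has_vector_derivative cis (\<theta> * s)) (at s within {0..T})" for s
    proof -
      have "((\<lambda>z::complex. - \<i> * exp (\<i> * (of_real \<theta> * z)) / of_real \<theta>) has_field_derivative exp (\<i> * (of_real \<theta> * of_real s))) (at (of_real s))"
        using False by (auto intro!: derivative_eq_intros)
      from has_vector_derivative_real_field[OF this] show ?thesis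
        unfolding F_def[abs_def] cis_conv_exp by (simp add: o_def)
    qed
    show "continuous_on {0..T} (\<lambda>s. cis (\<theta> * s))" by (intro continuous_intros)
  qed (use T in auto)
  also have "\<dots> = cis (\<theta> * T / 2) * (- \<i> * (cis (\<theta> * T / 2) - cis (- (\<theta> * T / 2))) / of_real \<theta>)"
    unfolding F_def using False by (simp add: field_simps cis_mult)
  also have "- \<i> * (cis (\<theta> * T / 2) - cis (- (\<theta> * T / 2))) / of_real \<theta> = of_real (2 * sin (\<theta> * T / 2) / \<theta>)"
    by (auto simp: complex_eq_iff)
  also have "2 * sin (\<theta> * T / 2) / \<theta> = sker T \<theta>"
    using False T by (simp add: sker_def nsinc_def field_simps)
  finally show ?thesis .
qed

lemma Fubini_bounded_complex:
  fixes a v :: "real \<Rightarrow> real" and G :: "real \<Rightarrow> real \<Rightarrow> complex"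
  assumes a: "integrable lborel a" and v: "integrable lborel v"
    and G [measurable]: "(\<lambda>(z, u). G z u) \<in> borel_measurable (borel \<Otimes>\<^sub>M borel)"
    and b: "\<And>z u. cmod (G z u) \<le> B"
  shows "(\<integral>z. a z *\<^sub>R (\<integral>u. v u *\<^sub>R G z u \<partial>lborel) \<partial>lborel) = (\<integral>u. v u *\<^sub>R (\<integral>z. a z *\<^sub>R G z u \<partial>lborel) \<partial>lborel)"
proof -
  have [measurable]: "a \<in> borel_measurable borel" "v \<in> borel_measurable borel" using a v by auto
  have "integrable (lborel \<Otimes>\<^sub>M lborel) (\<lambda>(z, u). 1 * a z * v u)"
    by (rule Fubini_bounded(1)[OF a v, where B = 1]) auto
  then have 1: "integrable (lborel \<Otimes>\<^sub>M lborel) (\<lambda>p. B * (case p of (z, u) \<Rightarrow> 1 * a z * v u))"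
    by (rule integrable_mult_right)
  have "integrable (lborel \<Otimes>\<^sub>M lborel) (\<lambda>(z, u). (a z * v u) *\<^sub>R G z u)"
  proof (rule Bochner_Integration.integrable_bound[OF 1])
    have "\<bar>a z * v u\<bar> * cmod (G z u) \<le> \<bar>B\<bar> * \<bar>a z * v u\<bar>" for z u
      using mult_left_mono[OF order_trans[OF b abs_ge_self], of "\<bar>a z * v u\<bar>" z u] by (simp add: mult.commute)
    then show "AE p in lborel \<Otimes>\<^sub>M lborel. norm (case p of (z, u) \<Rightarrow> (a z * v u) *\<^sub>R G z u) \<le> norm (B * (case p of (z, u) \<Rightarrow> 1 * a z * v u))"
      by (intro AE_I2) (auto simp: abs_mult)
  qed measurable
  note Fubini = lborel_pair.Fubini_integral[OF this]
  have 2: "(\<integral>u. (a z * v u) *\<^sub>R G z u \<partial>lborel) = a z *\<^sub>R (\<integral>u. v u *\<^sub>R G z u \<partial>lborel)" for z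
    unfolding scaleR_scaleR[symmetric] by (rule integral_scaleR_right)
  have 3: "(\<integral>z. (a z * v u) *\<^sub>R G z u \<partial>lborel) = v u *\<^sub>R (\<integral>z. a z *\<^sub>R G z u \<partial>lborel)" for u
    unfolding mult.commute[of _ "v u"] scaleR_scaleR[symmetric] by (rule integral_scaleR_right)
  show ?thesis using Fubini[symmetric] unfolding 2 3 .
qed

lemma integrable_indicator_Icc: "integrable lborel (indicator {a..b} :: real \<Rightarrow> real)"
  by (rule integrable_real_indicator) (auto simp: emeasure_lborel_Icc_eq)

definition toeplitz_chain :: "real \<Rightarrow> (real \<Rightarrow> real) list \<Rightarrow> (real \<Rightarrow> complex) \<Rightarrow> real \<Rightarrow> complex" where
  "toeplitz_chain T hs = foldr (\<lambda>h F. toeplitz_op T h \<circ> F) hs id"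

text \<open>Writing \<open>fourier_hat\<close> as an integral and exchanging shows the operator as:
  window, Fourier transform, multiply by the symbol, transform back.\<close>

lemma toeplitz_op_fourier:
  assumes h: "integrable lborel h"
    and [measurable]: "v \<in> borel_measurable borel" and b: "\<And>t. cmod (v t) \<le> B"
  shows "toeplitz_op T h v t = (\<integral>l. h l *\<^sub>R (cis (l * t) * (\<integral>s. indicator {0..T} s *\<^sub>R (cis (- (l * s)) * v s) \<partial>lborel)) \<partial>lborel)"
proof -
  have [measurable]: "h \<in> borel_measurable borel" using h by auto
  have "toeplitz_op T h v t = (\<integral>s. indicator {0..T} s *\<^sub>R (\<integral>l. h l *\<^sub>R (cis (l * (t - s)) * v s) \<partial>lborel) \<partial>lborel)"
  proof -
    have "fourier_hat h (t - s) * v s = (\<integral>l. h l *\<^sub>R (cis (l * (t - s)) * v s) \<partial>lborel)" for s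
      unfolding fourier_hat_def cis_conv_exp
      by (subst integral_mult_left_zero[symmetric]) (simp add: scaleR_conv_of_real mult_ac)
    then show ?thesis by (simp add: toeplitz_op_def set_lebesgue_integral_def)
  qed
  also have "\<dots> = (\<integral>l. h l *\<^sub>R (\<integral>s. indicator {0..T} s *\<^sub>R (cis (l * (t - s)) * v s) \<partial>lborel) \<partial>lborel)"
    by (rule Fubini_bounded_complex[where B = B]) (use h b in \<open>auto simp: norm_mult integrable_indicator_Icc\<close>)
  also have "\<dots> = (\<integral>l. h l *\<^sub>R (cis (l * t) * (\<integral>s. indicator {0..T} s *\<^sub>R (cis (- (l * s)) * v s) \<partial>lborel)) \<partial>lborel)"
  proof -
    have c: "cis (l * (t - s)) = cis (l * t) * cis (- (l * s))" for l s
      unfolding cis_mult by (simp add: right_diff_distrib)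
    have "indicator {0..T} s *\<^sub>R (cis (l * (t - s)) * v s) = cis (l * t) * (indicator {0..T} s *\<^sub>R (cis (- (l * s)) * v s))" for l s
      unfolding c by (simp add: scaleR_conv_of_real mult_ac)
    then show ?thesis by (simp only: integral_mult_right_zero)
  qed
  finally show ?thesis .
qed

lemma fourier_basis_eq_cis:
  "fourier_basis T n t = cis (2 * pi / T * of_int n * t) / of_real (sqrt T)"
  unfolding fourier_basis_def cis_conv_exp by (simp add: mult_ac)

text \<open>The induction follows the windowed Fourier transform of the image of a basis vector,
  because this transform obeys the recursion of \<open>ker\<close>. Measurability and boundedness
  are carried along for the next exchange of integrals.\<close>

lemma toeplitz_chain_transform:
  fixes n :: int
  assumes T: "T > 0" and "\<forall>h\<in>set hs. integrable lborel h"
  defines "w \<equiv> 2 * pi / T * of_int n"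
  shows "toeplitz_chain T hs (fourier_basis T n) \<in> borel_measurable borel \<and>
    (\<exists>B. \<forall>t. cmod (toeplitz_chain T hs (fourier_basis T n) t) \<le> B) \<and>
    (\<forall>l. (\<integral>s. indicator {0..T} s *\<^sub>R (cis (- (l * s)) * toeplitz_chain T hs (fourier_basis T n) s) \<partial>lborel) =
      cis ((w - l) * T / 2) * of_real (ker T hs l w / sqrt T))"
  using assms(2)
proof (induction hs)
  case Nil
  have e: "fourier_basis T n = (\<lambda>t. cis (w * t) / of_real (sqrt T))"
    by (auto simp: fourier_basis_eq_cis w_def)
  have "(\<integral>s. indicator {0..T} s *\<^sub>R (cis (- (l * s)) * (cis (w * s) / of_real (sqrt T))) \<partial>lborel) =
    cis ((w - l) * T / 2) * of_real (sker T (l - w) / sqrt T)" for l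
  proof -
    have "indicator {0..T} s *\<^sub>R (cis (- (l * s)) * (cis (w * s) / of_real (sqrt T))) =
      (indicator {0..T} s *\<^sub>R cis ((w - l) * s)) * (1 / of_real (sqrt T))" for s
      by (simp add: cis_mult left_diff_distrib scaleR_conv_of_real)
    then have "(\<integral>s. indicator {0..T} s *\<^sub>R (cis (- (l * s)) * (cis (w * s) / of_real (sqrt T))) \<partial>lborel)
      = (\<integral>s. indicator {0..T} s *\<^sub>R cis ((w - l) * s) \<partial>lborel) * (1 / of_real (sqrt T))"
      by (simp only: integral_mult_left_zero)
    then show ?thesis unfolding integral_cis_interval[OF T] by (simp add: sker_commute[of T w l])
  qed
  moreover have "cmod (cis (w * t) / of_real (sqrt T)) \<le> 1 / sqrt T" for t
    using T by (simp add: norm_divide)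
  ultimately show ?case unfolding e by (auto simp: toeplitz_chain_def)
next
  case (Cons h hs)
  have h: "integrable lborel h" and hs: "\<forall>h\<in>set hs. integrable lborel h" using Cons.prems by auto
  have [measurable]: "h \<in> borel_measurable borel" using h by auto
  note [measurable] = ker_measurable[OF hs]
  define v where "v = toeplitz_chain T hs (fourier_basis T n)"
  define c where "c l = cis ((w - l) * T / 2) * complex_of_real (ker T hs l w / sqrt T)" for l
  from Cons.IH[OF hs] obtain B where v: "v \<in> borel_measurable borel" "\<And>t. cmod (v t) \<le> B"
    "\<And>l. (\<integral>s. indicator {0..T} s *\<^sub>R (cis (- (l * s)) * v s) \<partial>lborel) = c l"
    unfolding v_def c_def by blast
  define V where "V = toeplitz_chain T (h # hs) (fourier_basis T n)"
  have V: "V t = (\<integral>l. h l *\<^sub>R (cis (l * t) * c l) \<partial>lborel)" for t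
    using toeplitz_op_fourier[OF h v(1,2), of T t] unfolding v(3) V_def by (simp add: toeplitz_chain_def v_def)
  have [measurable]: "c \<in> borel_measurable borel" unfolding c_def by measurable
  obtain C where C: "\<And>l. cmod (c l) \<le> C"
  proof
    show "cmod (c l) \<le> T * (\<Prod>h\<leftarrow>hs. T * (\<integral>z. \<bar>h z\<bar> \<partial>lborel)) / sqrt T" for l
      unfolding c_def norm_mult using T abs_ker_le[OF T hs, of l w] by (simp add: divide_right_mono norm_divide)
  qed
  have mV: "V \<in> borel_measurable borel" unfolding V[abs_def] by measurable
  have bV: "cmod (V t) \<le> (\<integral>l. \<bar>h l\<bar> * C \<partial>lborel)" for t
  proof -
    have ci: "integrable lborel (\<lambda>l. \<bar>h l\<bar> * C)" using h by auto
    have "cmod (V t) \<le> (\<integral>l. cmod (h l *\<^sub>R (cis (l * t) * c l)) \<partial>lborel)" unfolding V by (rule integral_norm_bound)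
    also have "\<dots> \<le> (\<integral>l. \<bar>h l\<bar> * C \<partial>lborel)"
    proof (rule integral_mono'[OF ci])
      show "cmod (h l *\<^sub>R (cis (l * t) * c l)) \<le> \<bar>h l\<bar> * C" for l
        using mult_left_mono[OF C, of "\<bar>h l\<bar>"] by (simp add: norm_mult)
      show "0 \<le> \<bar>h l\<bar> * C" for l using order_trans[OF norm_ge_zero C[of l]] by simp
    qed
    finally show ?thesis .
  qed
  have "(\<integral>s. indicator {0..T} s *\<^sub>R (cis (- (l * s)) * V s) \<partial>lborel) =
      cis ((w - l) * T / 2) * of_real (ker T (h # hs) l w / sqrt T)" for l
  proof -
    have "(\<integral>s. indicator {0..T} s *\<^sub>R (cis (- (l * s)) * V s) \<partial>lborel) =
      (\<integral>s. indicator {0..T} s *\<^sub>R (\<integral>x. h x *\<^sub>R (cis ((x - l) * s) * c x) \<partial>lborel) \<partial>lborel)"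
    proof -
      have "cis (- (l * s)) * V s = (\<integral>x. h x *\<^sub>R (cis ((x - l) * s) * c x) \<partial>lborel)" for s
      proof -
        have "h x *\<^sub>R (cis ((x - l) * s) * c x) = cis (- (l * s)) * (h x *\<^sub>R (cis (x * s) * c x))" for x
        proof -
          have "cis ((x - l) * s) = cis (- (l * s)) * cis (x * s)"
            unfolding cis_mult by (simp add: left_diff_distrib)
          then show ?thesis by (simp add: scaleR_conv_of_real mult_ac)
        qed
        then show ?thesis unfolding V by (simp only: integral_mult_right_zero)
      qed
      then show ?thesis by simp
    qed
    also have "\<dots> = (\<integral>x. h x *\<^sub>R (\<integral>s. indicator {0..T} s *\<^sub>R (cis ((x - l) * s) * c x) \<partial>lborel) \<partial>lborel)"
      by (rule Fubini_bounded_complex[where B = C]) (use h C in \<open>auto simp: norm_mult integrable_indicator_Icc\<close>)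
    also have "\<dots> = (\<integral>x. cis ((w - l) * T / 2) * of_real (sker T (l - x) * h x * ker T hs x w / sqrt T) \<partial>lborel)"
    proof (rule Bochner_Integration.integral_cong[OF refl])
      fix x
      have "(\<integral>s. indicator {0..T} s *\<^sub>R (cis ((x - l) * s) * c x) \<partial>lborel) = (\<integral>s. indicator {0..T} s *\<^sub>R cis ((x - l) * s) \<partial>lborel) * c x"
        by (subst integral_mult_left_zero[symmetric]) simp
      also have "\<dots> = (cis ((x - l) * T / 2) * cis ((w - x) * T / 2)) * of_real (sker T (l - x) * ker T hs x w / sqrt T)"
        unfolding integral_cis_interval[OF T] c_def by (simp add: sker_commute[of T x l])
      \<comment> \<open>The intermediate frequency \<open>x\<close> drops out of the phase, so what
        remains under the integral is real up to a constant factor.\<close>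
      also have "cis ((x - l) * T / 2) * cis ((w - x) * T / 2) = cis ((w - l) * T / 2)"
        unfolding cis_mult by (rule arg_cong[where f = cis]) (simp add: field_simps)
      finally show "h x *\<^sub>R (\<integral>s. indicator {0..T} s *\<^sub>R (cis ((x - l) * s) * c x) \<partial>lborel) =
        cis ((w - l) * T / 2) * of_real (sker T (l - x) * h x * ker T hs x w / sqrt T)"
        by (simp add: scaleR_conv_of_real)
    qed
    also have "\<dots> = cis ((w - l) * T / 2) * of_real (\<integral>x. sker T (l - x) * h x * ker T hs x w / sqrt T \<partial>lborel)"
      by (simp only: integral_mult_right_zero integral_complex_of_real)
    finally show ?thesis by simp
  qed
  with mV bV show ?case unfolding V_def[symmetric] by blast
qed

lemma toeplitz_chain_basis_coeff:
  assumes T: "T > 0" and hs: "\<forall>h\<in>set hs. integrable lborel h"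
  shows "(LINT t:{0..T}|lborel. toeplitz_chain T hs (fourier_basis T n) t * cnj (fourier_basis T n t)) =
    of_real (ker T hs (2 * pi / T * of_int n) (2 * pi / T * of_int n) / T)"
proof -
  define w where "w = 2 * pi / T * of_int n"
  have "indicator {0..T} t *\<^sub>R (toeplitz_chain T hs (fourier_basis T n) t * cnj (fourier_basis T n t)) =
    (indicator {0..T} t *\<^sub>R (cis (- (w * t)) * toeplitz_chain T hs (fourier_basis T n) t)) * (1 / of_real (sqrt T))" for t
    by (simp add: fourier_basis_eq_cis w_def cis_cnj mult_ac)
  then have "(LINT t:{0..T}|lborel. toeplitz_chain T hs (fourier_basis T n) t * cnj (fourier_basis T n t)) =
    cis ((w - w) * T / 2) * of_real (ker T hs w w / sqrt T) * (1 / of_real (sqrt T))"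
    unfolding set_lebesgue_integral_def
    using toeplitz_chain_transform[OF T hs, of n, folded w_def] by (simp only: integral_mult_left_zero)
  also have "\<dots> = of_real (ker T hs w w / sqrt T * (1 / sqrt T))"
    by (simp only: diff_self mult_zero_left div_0 cis_zero mult_1_left of_real_mult of_real_divide of_real_1)
  also have "ker T hs w w / sqrt T * (1 / sqrt T) = ker T hs w w / T" using T by simp
  finally show ?thesis by (simp only: w_def)
qed

text \<open>The lattice point occurs only in the two outer factors S(w - x) and S(z - w). Summing
  them by Parseval gives T S(z - x), which closes the chain into a cycle.\<close>

lemma has_sum_ker_lattice:
  assumes T: "T > 0" and h: "integrable lborel h" and hs: "\<forall>h\<in>set hs. integrable lborel h" and k: "integrable lborel k"
  shows "((\<lambda>n::int. ker T (h # hs @ [k]) (2 * pi / T * of_int n) (2 * pi / T * of_int n)) has_sum (T * cyc T (h # hs @ [k]))) UNIV"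
proof -
  define w where "w n = 2 * pi / T * real_of_int n" for n
  have [measurable]: "h \<in> borel_measurable borel" "k \<in> borel_measurable borel" using h k by auto
  note [measurable] = ker_measurable[OF hs]
  let ?H = "\<lambda>x z. ker T hs x z * h x * k z"
  have iH: "integrable (lborel \<Otimes>\<^sub>M lborel) (\<lambda>(x, z). ?H x z)"
    by (rule Fubini_bounded(1)[OF h k _ abs_ker_le[OF T hs]]) measurable
  have intH: "integrable (lborel \<Otimes>\<^sub>M lborel) (\<lambda>(x, z). G x z * ?H x z)"
    if [measurable]: "(\<lambda>(x, z). G x z) \<in> borel_measurable (borel \<Otimes>\<^sub>M borel)" and "\<And>x z. \<bar>G x z\<bar> \<le> B" for G B
    using integrable_mult_bounded[OF iH, of "\<lambda>(x, z). G x z" B] that by (simp add: case_prod_unfold)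
  have ker_eq: "ker T (h # hs @ [k]) (w n) (w n) = (\<integral>p. (case p of (x, z) \<Rightarrow> sker T (z - w n) * sker T (w n - x) * ?H x z) \<partial>(lborel \<Otimes>\<^sub>M lborel))" for n
  proof -
    have "ker T (h # hs @ [k]) (w n) (w n) = (\<integral>x. (\<integral>z. sker T (z - w n) * sker T (w n - x) * ?H x z \<partial>lborel) \<partial>lborel)"
      using ker_snoc[OF T hs k] by (simp add: mult_ac flip: integral_mult_right_zero)
    also have "\<dots> = (\<integral>p. (case p of (x, z) \<Rightarrow> sker T (z - w n) * sker T (w n - x) * ?H x z) \<partial>(lborel \<Otimes>\<^sub>M lborel))"
      by (rule lborel_pair.integral_fst, rule intH[where B = "T * T"])
        (use T abs_sker_le[OF T] in \<open>auto simp: abs_mult intro!: mult_mono\<close>)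
    finally show ?thesis .
  qed
  \<comment> \<open>The Bessel bound T^2 is uniform in the lattice sum and multiplies an integrable
    function of (x, z), so the sum passes under the integral.\<close>
  have "((\<lambda>n. \<integral>p. (case p of (x, z) \<Rightarrow> sker T (z - w n) * sker T (w n - x) * ?H x z) \<partial>(lborel \<Otimes>\<^sub>M lborel)) has_sum
     (\<integral>p. (case p of (x, z) \<Rightarrow> (T * sker T (z - x)) * ?H x z) \<partial>(lborel \<Otimes>\<^sub>M lborel))) UNIV"
  proof (rule has_sum_integral_int[where B = "\<lambda>p. T\<^sup>2 * \<bar>case p of (x, z) \<Rightarrow> ?H x z\<bar>"])
    show "((\<lambda>n. case p of (x, z) \<Rightarrow> sker T (z - w n) * sker T (w n - x) * ?H x z) has_sum
      (case p of (x, z) \<Rightarrow> (T * sker T (z - x)) * ?H x z)) UNIV" for p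
      unfolding w_def case_prod_beta by (intro has_sum_cmult_left sker_Parseval[OF T])
    show "(\<Sum>n\<in>N. \<bar>case p of (x, z) \<Rightarrow> sker T (z - w n) * sker T (w n - x) * ?H x z\<bar>) \<le> T\<^sup>2 * \<bar>case p of (x, z) \<Rightarrow> ?H x z\<bar>"
      if "finite N" for N p
      unfolding w_def case_prod_beta abs_mult[of "_ * _" "?H _ _"] sum_distrib_right[symmetric]
      by (intro mult_right_mono sker_Bessel[OF T that]) simp
    show "integrable (lborel \<Otimes>\<^sub>M lborel) (\<lambda>p. T\<^sup>2 * \<bar>case p of (x, z) \<Rightarrow> ?H x z\<bar>)"
      using iH by (intro integrable_mult_right integrable_abs)
  qed measurable
  moreover have "(\<integral>p. (case p of (x, z) \<Rightarrow> (T * sker T (z - x)) * ?H x z) \<partial>(lborel \<Otimes>\<^sub>M lborel)) = T * cyc T (h # hs @ [k])"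
  proof -
    have "(\<integral>p. (case p of (x, z) \<Rightarrow> (T * sker T (z - x)) * ?H x z) \<partial>(lborel \<Otimes>\<^sub>M lborel)) =
      (\<integral>x. (\<integral>z. (T * sker T (z - x)) * ?H x z \<partial>lborel) \<partial>lborel)"
      by (rule lborel_pair.integral_fst[symmetric], rule intH[where B = "T * T"])
        (use T abs_sker_le[OF T] in \<open>auto simp: abs_mult intro!: mult_mono\<close>)
    also have "\<dots> = T * cyc T (h # hs @ [k])"
      using ker_snoc[OF T hs k] by (simp add: mult_ac flip: integral_mult_right_zero)
    finally show ?thesis .
  qed
  ultimately show ?thesis unfolding w_def[symmetric] ker_eq by simp
qed

lemma op_trace_toeplitz_chain:
  assumes T: "T > 0" and h: "integrable lborel h" and hs: "\<forall>h\<in>set hs. integrable lborel h" and k: "integrable lborel k"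
  shows "op_trace T (toeplitz_chain T (h # hs @ [k])) = of_real (cyc T (h # hs @ [k]))"
proof -
  let ?hs = "h # hs @ [k]"
  have all: "\<forall>h\<in>set ?hs. integrable lborel h" using h hs k by auto
  have "((\<lambda>n::int. complex_of_real (1 / T * ker T ?hs (2 * pi / T * of_int n) (2 * pi / T * of_int n))) has_sum 
    of_real (1 / T * (T * cyc T ?hs))) UNIV"
    by (intro has_sum_bounded_linear[OF bounded_linear_of_real] has_sum_cmult_right has_sum_ker_lattice assms)
  then have "((\<lambda>n::int. LINT t:{0..T}|lborel. toeplitz_chain T ?hs (fourier_basis T n) t * cnj (fourier_basis T n t)) has_sum of_real (cyc T ?hs)) UNIV"
    unfolding toeplitz_chain_basis_coeff[OF T all] using T by (simp del: ker.simps cyc.simps)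
  then show ?thesis unfolding op_trace_def by (rule infsumI)
qed

section \<open>Truncation of the symbols\<close>

text \<open>The form is linear in its first symbol and the remaining chain is bounded on the
  diagonal, so only the L^1 size of the change matters.\<close>

lemma cyc_change_one:
  assumes T: "T > 0" and A: "integrable lborel A" and B: "integrable lborel B"
    and hs: "list_all2 bounded_integrable hs bs"
  shows "\<bar>cyc T (A # hs) - cyc T (B # hs)\<bar> \<le> T * (2 * pi) ^ length hs * prod_list bs * (\<integral>x. \<bar>A x - B x\<bar> \<partial>lborel)"
proof -
  have ihs: "\<forall>h\<in>set hs. integrable lborel h" using hs by (rule list_all2_bounded_integrable)
  have "cyc T (A # hs) - cyc T (B # hs) = (\<integral>x. A x * ker T hs x x - B x * ker T hs x x \<partial>lborel)"
    using integrable_ker_integrand(3)[OF T A ihs] integrable_ker_integrand(3)[OF T B ihs] by simp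
  also have "\<dots> = (\<integral>x. ker T hs x x * (A x - B x) \<partial>lborel)"
    by (simp add: algebra_simps)
  finally have "cyc T (A # hs) - cyc T (B # hs) = (\<integral>x. ker T hs x x * (A x - B x) \<partial>lborel)" .
  then show ?thesis
    using integral_mult_bounded_le[of lborel "\<lambda>x. A x - B x", OF _ ker_diagonal_le[OF T hs]] A B by simp
qed

text \<open>Hybrid argument: symbols are exchanged one at a time from the left, \<open>pre\<close>
  holding those already exchanged. The quotient by \<open>b p\<close> is the product of the bounds
  of the other symbols.\<close>

lemma cyc_change_all:
  fixes A B :: "'p \<Rightarrow> real \<Rightarrow> real" and b :: "'p \<Rightarrow> real"
  assumes T: "T > 0"
    and "\<And>p. p \<in> set (pre @ ps) \<Longrightarrow> bounded_integrable (A p) (b p) \<and> bounded_integrable (B p) (b p) \<and> 0 < b p"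
  shows "\<bar>cyc T (map B pre @ map A ps) - cyc T (map B pre @ map B ps)\<bar> \<le>
    T * (2 * pi) ^ (length (pre @ ps) - 1) * (\<Sum>p\<leftarrow>ps. prod_list (map b (pre @ ps)) / b p * (\<integral>x. \<bar>A p x - B p x\<bar> \<partial>lborel))"
  using assms(2)
proof (induction ps arbitrary: pre)
  case Nil
  show ?case by simp
next
  case (Cons p ps)
  let ?c = "T * (2 * pi) ^ (length (pre @ p # ps) - 1)" and ?D = "\<lambda>p. \<integral>x. \<bar>A p x - B p x\<bar> \<partial>lborel"
  let ?P = "prod_list (map b (pre @ p # ps))"
  have IH: "\<bar>cyc T (map B (pre @ [p]) @ map A ps) - cyc T (map B (pre @ [p]) @ map B ps)\<bar> \<le>
    ?c * (\<Sum>p\<leftarrow>ps. ?P / b p * ?D p)"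
    using Cons.IH[of "pre @ [p]"] Cons.prems by simp
  have bi: "list_all2 bounded_integrable (map A ps @ map B pre) (map b (ps @ pre))"
    unfolding map_append using Cons.prems
    by (intro list_all2_appendI) (auto simp: list_all2_map1 list_all2_map2 list.rel_refl_strong intro!: list.rel_refl_strong)
  have int: "\<forall>h\<in>set (map B pre). integrable lborel h" "\<forall>h\<in>set (A p # map A ps). integrable lborel h"
    "\<forall>h\<in>set (B p # map A ps). integrable lborel h" using Cons.prems by auto
  \<comment> \<open>Cyclic rotation moves the symbol being exchanged to the front.\<close>
  have "\<bar>cyc T (map B pre @ map A (p # ps)) - cyc T (map B (pre @ [p]) @ map A ps)\<bar> =
    \<bar>cyc T (A p # map A ps @ map B pre) - cyc T (B p # map A ps @ map B pre)\<bar>"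
    using cyc_rotate[OF T int(1,2)] cyc_rotate[OF T int(1,3)] by simp
  also have "\<dots> \<le> T * (2 * pi) ^ length (map A ps @ map B pre) * prod_list (map b (ps @ pre)) * ?D p"
    using Cons.prems by (intro cyc_change_one[OF T _ _ bi]) auto
  also have "\<dots> = ?c * (?P / b p * ?D p)"
    using Cons.prems[of p] by (simp add: add.commute)
  finally have "\<bar>cyc T (map B pre @ map A (p # ps)) - cyc T (map B (pre @ [p]) @ map A ps)\<bar> \<le> ?c * (?P / b p * ?D p)" .
  moreover have Z: "map B pre @ map B (p # ps) = map B (pre @ [p]) @ map B ps" by simp
  moreover have S: "?c * (\<Sum>p\<leftarrow>p # ps. ?P / b p * ?D p) = ?c * (?P / b p * ?D p) + ?c * (\<Sum>p\<leftarrow>ps. ?P / b p * ?D p)"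
    by (simp only: list.map sum_list.Cons distrib_left)
  ultimately show ?case using IH unfolding Z S by linarith
qed

text \<open>Dominated convergence at fixed T. The bound independent of k is proved in the same
  induction because it provides the majorant for the next integral.\<close>

lemma ker_tendsto:
  fixes A :: "nat \<Rightarrow> 'p \<Rightarrow> real \<Rightarrow> real" and f :: "'p \<Rightarrow> real \<Rightarrow> real"
  assumes T: "T > 0"
    and "\<And>p. p \<in> set ps \<Longrightarrow> integrable lborel (f p)"
    and "\<And>k p. p \<in> set ps \<Longrightarrow> integrable lborel (A k p)"
    and "\<And>k p x. p \<in> set ps \<Longrightarrow> \<bar>A k p x\<bar> \<le> \<bar>f p x\<bar>"
    and "\<And>p x. p \<in> set ps \<Longrightarrow> (\<lambda>k. A k p x) \<longlonglongrightarrow> f p x"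
  shows "(\<lambda>k. ker T (map (A k) ps) x y) \<longlonglongrightarrow> ker T (map f ps) x y
    \<and> (\<forall>k. \<bar>ker T (map (A k) ps) x y\<bar> \<le> T * (\<Prod>p\<leftarrow>ps. T * (\<integral>z. \<bar>f p z\<bar> \<partial>lborel)))"
  using assms(2-)
proof (induction ps arbitrary: x)
  case Nil
  show ?case using abs_sker_le[OF T] by simp
next
  case (Cons p ps)
  let ?B = "T * (\<Prod>p\<leftarrow>ps. T * (\<integral>z. \<bar>f p z\<bar> \<partial>lborel))"
  have IH: "(\<lambda>k. ker T (map (A k) ps) z y) \<longlonglongrightarrow> ker T (map f ps) z y"
    "\<bar>ker T (map (A k) ps) z y\<bar> \<le> ?B" for z k
    using Cons.IH[of z] Cons.prems by auto
  have fp: "integrable lborel (f p)" "\<And>k. integrable lborel (A k p)" "\<And>k x. \<bar>A k p x\<bar> \<le> \<bar>f p x\<bar>" "\<And>x. (\<lambda>k. A k p x) \<longlonglongrightarrow> f p x"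
    using Cons.prems by auto
  have ints: "\<forall>h\<in>set (map f ps). integrable lborel h" "\<And>k. \<forall>h\<in>set (map (A k) ps). integrable lborel h"
    using Cons.prems by auto
  have bd: "\<bar>sker T (x - z) * A k p z * ker T (map (A k) ps) z y\<bar> \<le> T * \<bar>f p z\<bar> * ?B" for k z
    unfolding abs_mult using abs_sker_le[OF T] fp(3) IH(2) T by (intro mult_mono) auto
  have iB: "integrable lborel (\<lambda>z. T * \<bar>f p z\<bar> * ?B)" using fp(1) by auto
  have "(\<lambda>k. \<integral>z. sker T (x - z) * A k p z * ker T (map (A k) ps) z y \<partial>lborel) \<longlonglongrightarrow>
    (\<integral>z. sker T (x - z) * f p z * ker T (map f ps) z y \<partial>lborel)"
  proof (rule integral_dominated_convergence[where w = "\<lambda>z. T * \<bar>f p z\<bar> * ?B"])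
    show "AE z in lborel. (\<lambda>k. sker T (x - z) * A k p z * ker T (map (A k) ps) z y) \<longlonglongrightarrow> sker T (x - z) * f p z * ker T (map f ps) z y"
      by (intro AE_I2 tendsto_mult tendsto_const fp IH)
    show "AE z in lborel. norm (sker T (x - z) * A k p z * ker T (map (A k) ps) z y) \<le> T * \<bar>f p z\<bar> * ?B" for k
      using bd by simp
    show "(\<lambda>z. sker T (x - z) * f p z * ker T (map f ps) z y) \<in> borel_measurable lborel"
      using integrable_ker_integrand(2)[OF T fp(1) ints(1)] by (rule borel_measurable_integrable)
    show "(\<lambda>z. sker T (x - z) * A k p z * ker T (map (A k) ps) z y) \<in> borel_measurable lborel" for k
      using integrable_ker_integrand(2)[OF T fp(2) ints(2)] by (rule borel_measurable_integrable)
  qed (rule iB)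
  moreover have "\<bar>ker T (map (A k) (p # ps)) x y\<bar> \<le> T * (\<Prod>p\<leftarrow>p # ps. T * (\<integral>z. \<bar>f p z\<bar> \<partial>lborel))" for k
  proof -
    have "\<bar>ker T (map (A k) (p # ps)) x y\<bar> \<le> (\<integral>z. \<bar>sker T (x - z) * A k p z * ker T (map (A k) ps) z y\<bar> \<partial>lborel)"
      by simp
    also have "\<dots> \<le> (\<integral>z. T * \<bar>f p z\<bar> * ?B \<partial>lborel)"
      by (rule integral_mono[OF _ iB bd]) (rule integrable_abs, rule integrable_ker_integrand(2)[OF T fp(2) ints(2)])
    also have "\<dots> = T * (\<Prod>p\<leftarrow>p # ps. T * (\<integral>z. \<bar>f p z\<bar> \<partial>lborel))" by (simp add: mult_ac)
    finally show ?thesis .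
  qed
  ultimately show ?case by simp
qed

lemma cyc_tendsto:
  fixes A :: "nat \<Rightarrow> 'p \<Rightarrow> real \<Rightarrow> real" and f :: "'p \<Rightarrow> real \<Rightarrow> real"
  assumes T: "T > 0"
    and f: "\<And>p. p \<in> set ps \<Longrightarrow> integrable lborel (f p)"
    and A: "\<And>k p. p \<in> set ps \<Longrightarrow> integrable lborel (A k p)"
    and le: "\<And>k p x. p \<in> set ps \<Longrightarrow> \<bar>A k p x\<bar> \<le> \<bar>f p x\<bar>"
    and lim: "\<And>p x. p \<in> set ps \<Longrightarrow> (\<lambda>k. A k p x) \<longlonglongrightarrow> f p x"
  shows "(\<lambda>k. cyc T (map (A k) ps)) \<longlonglongrightarrow> cyc T (map f ps)"
proof (cases ps)
  case Nil
  then show ?thesis by simp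
next
  case (Cons p qs)
  let ?B = "T * (\<Prod>p\<leftarrow>qs. T * (\<integral>z. \<bar>f p z\<bar> \<partial>lborel))"
  have K: "(\<lambda>k. ker T (map (A k) qs) x x) \<longlonglongrightarrow> ker T (map f qs) x x" "\<bar>ker T (map (A k) qs) x x\<bar> \<le> ?B" for x k
    using ker_tendsto[OF T, of qs f A x x] assms Cons by auto
  have fp: "integrable lborel (f p)" "\<And>k. integrable lborel (A k p)" "\<And>k x. \<bar>A k p x\<bar> \<le> \<bar>f p x\<bar>" "\<And>x. (\<lambda>k. A k p x) \<longlonglongrightarrow> f p x"
    using assms Cons by auto
  have ints: "\<forall>h\<in>set (map f qs). integrable lborel h" "\<And>k. \<forall>h\<in>set (map (A k) qs). integrable lborel h"
    using assms Cons by auto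
  have "(\<lambda>k. \<integral>x. A k p x * ker T (map (A k) qs) x x \<partial>lborel) \<longlonglongrightarrow> (\<integral>x. f p x * ker T (map f qs) x x \<partial>lborel)"
  proof (rule integral_dominated_convergence[where w = "\<lambda>x. \<bar>f p x\<bar> * ?B"])
    show "AE x in lborel. (\<lambda>k. A k p x * ker T (map (A k) qs) x x) \<longlonglongrightarrow> f p x * ker T (map f qs) x x"
      by (intro AE_I2 tendsto_mult fp K)
    show "AE x in lborel. norm (A k p x * ker T (map (A k) qs) x x) \<le> \<bar>f p x\<bar> * ?B" for k
      unfolding real_norm_def abs_mult using fp(3) K(2) by (intro AE_I2 mult_mono) auto
    show "(\<lambda>x. f p x * ker T (map f qs) x x) \<in> borel_measurable lborel"
      using integrable_ker_integrand(3)[OF T fp(1) ints(1)] by (rule borel_measurable_integrable)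
    show "(\<lambda>x. A k p x * ker T (map (A k) qs) x x) \<in> borel_measurable lborel" for k
      using integrable_ker_integrand(3)[OF T fp(2) ints(2)] by (rule borel_measurable_integrable)
  qed (use fp(1) in auto)
  then show ?thesis unfolding Cons by simp
qed

section \<open>Dyadic truncation by powers of the symbols\<close>

definition trunc :: "nat \<Rightarrow> (real \<Rightarrow> real) \<times> real \<Rightarrow> real \<Rightarrow> real" where
  "trunc k p x = (if \<bar>fst p x\<bar> powr snd p \<le> 2 ^ k then fst p x else 0)"

definition trunc_mass :: "nat \<Rightarrow> (real \<Rightarrow> real) \<times> real \<Rightarrow> real" where
  "trunc_mass k p = (\<integral>x. (if \<bar>fst p x\<bar> powr snd p \<le> 2 ^ k then \<bar>fst p x\<bar> powr snd p else 0) \<partial>lborel)"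

definition admissible :: "(real \<Rightarrow> real) \<times> real \<Rightarrow> bool" where
  "admissible p \<longleftrightarrow> integrable lborel (fst p) \<and> snd p \<ge> 1 \<and> integrable lborel (\<lambda>x. \<bar>fst p x\<bar> powr snd p)"

lemma abs_le_powr_inverse:
  assumes "\<bar>y\<bar> powr r \<le> s" "r > 0"
  shows "\<bar>y::real\<bar> \<le> s powr (1 / r)"
proof -
  have "\<bar>y\<bar> = (\<bar>y\<bar> powr r) powr (1 / r)" using assms(2) by (simp add: powr_powr)
  also have "\<dots> \<le> s powr (1 / r)" by (rule powr_mono2) (use assms in auto)
  finally show ?thesis .
qed

text \<open>The bound is stated for any later level \<open>m\<close>, so that two consecutive
  truncations can share the bound of the higher one.\<close>

lemma trunc_bounded_integrable:
  assumes p: "admissible p" and "k \<le> m"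
  shows "bounded_integrable (trunc k p) ((2 ^ m) powr (1 / snd p))"
proof
  have [measurable]: "fst p \<in> borel_measurable borel" using p by (auto simp: admissible_def)
  have f: "integrable lborel (fst p)" using p by (simp add: admissible_def)
  show "integrable lborel (trunc k p)"
  proof (rule Bochner_Integration.integrable_bound[OF f])
    show "trunc k p \<in> borel_measurable lborel" unfolding trunc_def[abs_def] by measurable
  qed (auto simp: trunc_def)
  have r: "snd p > 0" using p by (simp add: admissible_def)
  have "y \<le> 2 ^ m" if "y \<le> 2 ^ k" for y :: real
    using that power_increasing[OF assms(2), of "2::real"] by linarith
  then show "\<forall>x. \<bar>trunc k p x\<bar> \<le> (2 ^ m) powr (1 / snd p)"
    using abs_le_powr_inverse[OF _ r] by (simp add: trunc_def)
qed

text \<open>Where the two truncations differ, |h| is at most the bound b and 2^(k+1) is less than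
  twice |h|^r; hence 2^(k+1) |h| / b \<le> 2 |h|^r. The factor 2 is the ratio of consecutive
  levels.\<close>

lemma trunc_step_le:
  assumes p: "admissible p"
  shows "2 ^ Suc k / (2 ^ Suc k) powr (1 / snd p) * (\<integral>x. \<bar>trunc (Suc k) p x - trunc k p x\<bar> \<partial>lborel)
    \<le> 2 * (trunc_mass (Suc k) p - trunc_mass k p)"
proof -
  let ?b = "(2 ^ Suc k) powr (1 / snd p) :: real" and ?s = "2 ^ Suc k :: real"
  have b: "?b > 0" by simp
  have [measurable]: "fst p \<in> borel_measurable borel" using p by (auto simp: admissible_def)
  have r: "snd p > 0" and ir: "integrable lborel (\<lambda>x. \<bar>fst p x\<bar> powr snd p)" using p by (auto simp: admissible_def)
  define M where "M k x = (if \<bar>fst p x\<bar> powr snd p \<le> 2 ^ k then \<bar>fst p x\<bar> powr snd p else 0)" for k :: nat and x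
  have iM: "integrable lborel (M k)" for k
  proof (rule Bochner_Integration.integrable_bound[OF ir])
    show "M k \<in> borel_measurable lborel" unfolding M_def[abs_def] by measurable
  qed (auto simp: M_def)
  have "?s / ?b * \<bar>trunc (Suc k) p x - trunc k p x\<bar> \<le> 2 * (M (Suc k) x - M k x)" for x
  proof -
    consider "\<bar>fst p x\<bar> powr snd p \<le> 2 ^ k" | "\<bar>fst p x\<bar> powr snd p > ?s"
      | "2 ^ k < \<bar>fst p x\<bar> powr snd p" "\<bar>fst p x\<bar> powr snd p \<le> ?s" by linarith
    then show ?thesis
    proof cases
      case 1
      then have "\<bar>fst p x\<bar> powr snd p \<le> ?s" using power_increasing[of k "Suc k" "2::real"] by linarith
      with 1 show ?thesis by (simp add: trunc_def M_def)
    next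
      case 2
      then have "\<not> \<bar>fst p x\<bar> powr snd p \<le> 2 ^ k" using power_increasing[of k "Suc k" "2::real"] by linarith
      with 2 show ?thesis by (simp add: trunc_def M_def)
    next
      case 3
      have "\<bar>fst p x\<bar> / ?b \<le> 1" using abs_le_powr_inverse[OF 3(2) r] b by simp
      then have "?s * (\<bar>fst p x\<bar> / ?b) \<le> ?s * 1" by (rule mult_left_mono) simp
      also have "\<dots> \<le> 2 * (\<bar>fst p x\<bar> powr snd p)" using 3(1) by simp
      finally show ?thesis using 3 by (simp add: trunc_def M_def)
    qed
  qed
  moreover have "integrable lborel (trunc (Suc k) p)" "integrable lborel (trunc k p)"
    using trunc_bounded_integrable[OF p order_refl] by auto
  ultimately have "(\<integral>x. ?s / ?b * \<bar>trunc (Suc k) p x - trunc k p x\<bar> \<partial>lborel) \<le> (\<integral>x. 2 * (M (Suc k) x - M k x) \<partial>lborel)"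
    using iM by (intro integral_mono integrable_mult_right integrable_abs Bochner_Integration.integrable_diff) auto
  also have "\<dots> = 2 * (trunc_mass (Suc k) p - trunc_mass k p)"
    unfolding trunc_mass_def M_def[symmetric] using iM by simp
  finally show ?thesis by simp
qed

lemma trunc_tendsto: "(\<lambda>k. trunc k p x) \<longlonglongrightarrow> fst p x"
proof (rule tendsto_eventually)
  obtain N where "\<bar>fst p x\<bar> powr snd p < 2 ^ N" using real_arch_pow[of 2] by auto
  then have "\<bar>fst p x\<bar> powr snd p \<le> 2 ^ k" if "k \<ge> N" for k
    using power_increasing[OF that, of "2::real"] \<open>_ < 2 ^ N\<close> by linarith
  then show "\<forall>\<^sub>F k in sequentially. trunc k p x = fst p x"
    unfolding eventually_sequentially trunc_def by auto
qed

lemma trunc_mass_limit: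
  assumes p: "admissible p"
  shows "(\<lambda>k. trunc_mass k p) \<longlonglongrightarrow> (\<integral>x. \<bar>fst p x\<bar> powr snd p \<partial>lborel)"
    and "trunc_mass k p \<le> (\<integral>x. \<bar>fst p x\<bar> powr snd p \<partial>lborel)"
proof -
  have [measurable]: "fst p \<in> borel_measurable borel" using p by (auto simp: admissible_def)
  have r: "snd p > 0" and ir: "integrable lborel (\<lambda>x. \<bar>fst p x\<bar> powr snd p)" using p by (auto simp: admissible_def)
  have e: "(if \<bar>fst p x\<bar> powr snd p \<le> 2 ^ k then \<bar>fst p x\<bar> powr snd p else 0) = \<bar>trunc k p x\<bar> powr snd p" for x and k :: nat
    using r by (simp add: trunc_def)
  have [measurable]: "trunc k p \<in> borel_measurable borel" for k unfolding trunc_def[abs_def] by measurable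
  have le: "\<bar>trunc k p x\<bar> powr snd p \<le> \<bar>fst p x\<bar> powr snd p" for x k by (simp add: trunc_def)
  show "(\<lambda>k. trunc_mass k p) \<longlonglongrightarrow> (\<integral>x. \<bar>fst p x\<bar> powr snd p \<partial>lborel)"
    unfolding trunc_mass_def e
  proof (rule integral_dominated_convergence[OF _ _ ir])
    show "AE x in lborel. (\<lambda>k. \<bar>trunc k p x\<bar> powr snd p) \<longlonglongrightarrow> \<bar>fst p x\<bar> powr snd p"
      by (intro AE_I2 tendsto_powr' tendsto_rabs trunc_tendsto tendsto_const) (use r in auto)
  qed (use le in auto)
  show "trunc_mass k p \<le> (\<integral>x. \<bar>fst p x\<bar> powr snd p \<partial>lborel)"
    unfolding trunc_mass_def e by (rule integral_mono'[OF ir le]) simp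
qed

text \<open>The single-step costs telescope to a tail of moments, and the top level is sent to
  infinity with T fixed. The result is linear in T, with a tail that depends on k only.\<close>

lemma cyc_trunc_diff_le:
  assumes T: "T > 0" and ps: "\<forall>p\<in>set ps. admissible p" and s: "(\<Sum>p\<leftarrow>ps. 1 / snd p) = 1"
  shows "\<bar>cyc T (map fst ps) - cyc T (map (trunc k) ps)\<bar> \<le>
    2 * T * (2 * pi) ^ (length ps - 1) * ((\<Sum>p\<leftarrow>ps. \<integral>x. \<bar>fst p x\<bar> powr snd p \<partial>lborel) - (\<Sum>p\<leftarrow>ps. trunc_mass k p))"
proof -
  let ?C = "2 * T * (2 * pi) ^ (length ps - 1)" and ?a = "\<lambda>k. \<Sum>p\<leftarrow>ps. trunc_mass k p"
  let ?A = "\<Sum>p\<leftarrow>ps. \<integral>x. \<bar>fst p x\<bar> powr snd p \<partial>lborel"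
  have prod: "prod_list (map (\<lambda>p. s powr (1 / snd p)) qs) = s powr (\<Sum>p\<leftarrow>qs. 1 / snd p)"
    if "s > 0" for s :: real and qs :: "((real \<Rightarrow> real) \<times> real) list"
    using that by (induction qs) (auto simp: powr_add)
  have step: "\<bar>cyc T (map (trunc (Suc k)) ps) - cyc T (map (trunc k) ps)\<bar> \<le> ?C * (?a (Suc k) - ?a k)" for k
  proof -
    let ?b = "\<lambda>p :: (real \<Rightarrow> real) \<times> real. (2 ^ Suc k) powr (1 / snd p) :: real"
    \<comment> \<open>Here the reciprocals summing to 1 enter: the product of the bounds is exactly
      2^(k+1), matching the weight in \<open>trunc_step_le\<close>.\<close>
    have P: "prod_list (map ?b ps) = 2 ^ Suc k" unfolding prod[of "2 ^ Suc k", simplified] using s prod[of "2 ^ Suc k" ps] by simp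
    have "\<bar>cyc T (map (trunc (Suc k)) ps) - cyc T (map (trunc k) ps)\<bar> \<le>
      T * (2 * pi) ^ (length ps - 1) * (\<Sum>p\<leftarrow>ps. 2 ^ Suc k / ?b p * (\<integral>x. \<bar>trunc (Suc k) p x - trunc k p x\<bar> \<partial>lborel))"
      using cyc_change_all[OF T, of "[]" ps "trunc (Suc k)" ?b "trunc k"] ps P
        trunc_bounded_integrable[of _ "Suc k" "Suc k"] trunc_bounded_integrable[of _ k "Suc k"] by simp
    also have "\<dots> \<le> T * (2 * pi) ^ (length ps - 1) * (\<Sum>p\<leftarrow>ps. 2 * (trunc_mass (Suc k) p - trunc_mass k p))"
      using T ps trunc_step_le by (intro mult_left_mono sum_list_mono) auto
    also have "\<dots> = ?C * (?a (Suc k) - ?a k)"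
      by (simp add: sum_list_const_mult sum_list_subtractf)
    finally show ?thesis .
  qed
  have tele: "\<bar>cyc T (map (trunc (k + m)) ps) - cyc T (map (trunc k) ps)\<bar> \<le> ?C * (?a (k + m) - ?a k)" for m
  proof (induction m)
    case (Suc m)
    have "?C * (?a (k + Suc m) - ?a k) = ?C * (?a (Suc (k + m)) - ?a (k + m)) + ?C * (?a (k + m) - ?a k)"
      by (simp add: algebra_simps)
    with Suc step[of "k + m"] show ?case unfolding add_Suc_right by linarith
  qed simp
  have aA: "?a m \<le> ?A" for m using ps trunc_mass_limit(2) by (intro sum_list_mono) auto
  have "\<bar>cyc T (map (trunc (k + m)) ps) - cyc T (map (trunc k) ps)\<bar> \<le> ?C * (?A - ?a k)" for m
    by (rule order_trans[OF tele mult_left_mono]) (use aA T in auto)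
  moreover have "(\<lambda>m. cyc T (map (trunc m) ps)) \<longlonglongrightarrow> cyc T (map fst ps)"
    by (rule cyc_tendsto[OF T]) (use ps trunc_bounded_integrable[OF _ order_refl] in \<open>auto simp: admissible_def trunc_def intro!: trunc_tendsto[unfolded trunc_def]\<close>)
  then have "(\<lambda>m. cyc T (map (trunc (k + m)) ps)) \<longlonglongrightarrow> cyc T (map fst ps)"
    unfolding add.commute[of k] by (rule LIMSEQ_ignore_initial_segment)
  then have "(\<lambda>m. \<bar>cyc T (map (trunc (k + m)) ps) - cyc T (map (trunc k) ps)\<bar>) \<longlonglongrightarrow> \<bar>cyc T (map fst ps) - cyc T (map (trunc k) ps)\<bar>"
    by (intro tendsto_intros)
  ultimately show ?thesis by (intro LIMSEQ_le_const2) auto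
qed

text \<open>With S the sum of all powers, each factor is at most S^(1/r_i), and the exponents add up
  to 1. This plays the part of Young's inequality in providing an integrable majorant.\<close>

lemma prod_list_abs_le:
  assumes "\<forall>p\<in>set ps. snd p \<ge> (1::real)" and s: "(\<Sum>p\<leftarrow>ps. 1 / snd p) = 1"
  shows "(\<Prod>p\<leftarrow>ps. \<bar>fst p x :: real\<bar>) \<le> (\<Sum>p\<leftarrow>ps. \<bar>fst p x\<bar> powr snd p)"
proof -
  let ?S = "\<Sum>p\<leftarrow>ps. \<bar>fst p x\<bar> powr snd p"
  have S: "?S \<ge> 0" by (intro sum_list_nonneg) auto
  \<comment> \<open>S stays fixed while the induction runs over sublists. They are nonempty because
    for S = 0 the power with exponent 0 is 0 by convention, whereas the empty product is 1.\<close>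
  have "(\<Prod>p\<leftarrow>qs. \<bar>fst p x\<bar>) \<le> ?S powr (\<Sum>p\<leftarrow>qs. 1 / snd p)" if "qs \<noteq> []" "set qs \<subseteq> set ps" for qs
    using that
  proof (induction qs rule: list_nonempty_induct)
    case (single p)
    then have "\<bar>fst p x\<bar> powr snd p \<le> ?S" by (intro member_le_sum_list) auto
    then show ?case using single assms(1) by (auto intro!: abs_le_powr_inverse)
  next
    case (cons p qs)
    then have "\<bar>fst p x\<bar> powr snd p \<le> ?S" by (intro member_le_sum_list) auto
    then have "\<bar>fst p x\<bar> \<le> ?S powr (1 / snd p)" using cons assms(1) by (auto intro!: abs_le_powr_inverse)
    moreover have "(\<Prod>p\<leftarrow>qs. \<bar>fst p x\<bar>) \<le> ?S powr (\<Sum>p\<leftarrow>qs. 1 / snd p)" using cons by simp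
    moreover have "0 \<le> (\<Prod>p\<leftarrow>qs. \<bar>fst p x\<bar>)" by (induction qs) auto
    ultimately show ?case by (simp add: powr_add mult_mono)
  qed
  moreover have "ps \<noteq> []" using s by auto
  ultimately have "(\<Prod>p\<leftarrow>ps. \<bar>fst p x\<bar>) \<le> ?S powr 1" using s by fastforce
  then show ?thesis using S by simp
qed

lemma prod_list_tendsto:
  fixes A :: "nat \<Rightarrow> 'p \<Rightarrow> real"
  assumes "\<And>p. p \<in> set ps \<Longrightarrow> (\<lambda>k. A k p) \<longlonglongrightarrow> f p"
  shows "(\<lambda>k. prod_list (map (A k) ps)) \<longlonglongrightarrow> prod_list (map f ps)"
  using assms by (induction ps) (auto intro!: tendsto_mult)

lemma integral_prod_trunc_tendsto:
  assumes ps: "\<forall>p\<in>set ps. admissible p" and s: "(\<Sum>p\<leftarrow>ps. 1 / snd p) = 1"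
  shows "(\<lambda>k. \<integral>x. (\<Prod>p\<leftarrow>ps. trunc k p x) \<partial>lborel) \<longlonglongrightarrow> (\<integral>x. (\<Prod>p\<leftarrow>ps. fst p x) \<partial>lborel)"
proof (rule integral_dominated_convergence[where w = "\<lambda>x. \<Sum>p\<leftarrow>ps. \<bar>fst p x\<bar> powr snd p"])
  have m1: "(\<lambda>x. \<Prod>p\<leftarrow>qs. f p x) \<in> borel_measurable lborel"
    if "\<And>p. p \<in> set qs \<Longrightarrow> f p \<in> borel_measurable borel" for f :: "(real \<Rightarrow> real) \<times> real \<Rightarrow> real \<Rightarrow> real" and qs
    using that by (induction qs) auto
  have mf: "fst p \<in> borel_measurable borel" if "p \<in> set ps" for p using ps that by (auto simp: admissible_def)
  have mt: "trunc k p \<in> borel_measurable borel" if "p \<in> set ps" for p k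
    using trunc_bounded_integrable[of p k k] ps that by auto
  show "(\<lambda>x. \<Prod>p\<leftarrow>ps. fst p x) \<in> borel_measurable lborel" by (rule m1[OF mf])
  show "(\<lambda>x. \<Prod>p\<leftarrow>ps. trunc k p x) \<in> borel_measurable lborel" for k by (rule m1[OF mt])
  have "integrable lborel (\<lambda>x. \<Sum>p\<leftarrow>qs. \<bar>fst p x\<bar> powr snd p)" if "\<forall>p\<in>set qs. admissible p" for qs
    using that by (induction qs) (auto simp: admissible_def)
  then show "integrable lborel (\<lambda>x. \<Sum>p\<leftarrow>ps. \<bar>fst p x\<bar> powr snd p)" using ps by blast
  show "AE x in lborel. (\<lambda>k. \<Prod>p\<leftarrow>ps. trunc k p x) \<longlonglongrightarrow> (\<Prod>p\<leftarrow>ps. fst p x)"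
    by (intro AE_I2 prod_list_tendsto trunc_tendsto)
  have "\<bar>\<Prod>p\<leftarrow>qs. trunc k p x\<bar> \<le> (\<Prod>p\<leftarrow>qs. \<bar>fst p x\<bar>)" for qs k x
    by (induction qs) (auto simp: abs_mult trunc_def intro!: mult_mono)
  then show "AE x in lborel. norm (\<Prod>p\<leftarrow>ps. trunc k p x) \<le> (\<Sum>p\<leftarrow>ps. \<bar>fst p x\<bar> powr snd p)" for k
    unfolding real_norm_def
    by (intro AE_I2 order_trans[OF _ prod_list_abs_le[OF _ s]]) (use ps in \<open>auto simp: admissible_def\<close>)
qed

lemma cyc_limit:
  assumes ps: "\<forall>p\<in>set ps. admissible p" and s: "(\<Sum>p\<leftarrow>ps. 1 / snd p) = 1"
  shows "((\<lambda>T. cyc T (map fst ps) / T) \<longlongrightarrow> (2 * pi) ^ (length ps - 1) * (\<integral>x. (\<Prod>p\<leftarrow>ps. fst p x) \<partial>lborel)) at_top"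
proof (rule tendstoI)
  fix e :: real assume e: "e > 0"
  let ?c = "(2 * pi) ^ (length ps - 1)"
  let ?L = "?c * (\<integral>x. (\<Prod>p\<leftarrow>ps. fst p x) \<partial>lborel)" and ?Lk = "\<lambda>k. ?c * (\<integral>x. (\<Prod>p\<leftarrow>ps. trunc k p x) \<partial>lborel)"
  let ?d = "\<lambda>k. 2 * ?c * ((\<Sum>p\<leftarrow>ps. \<integral>x. \<bar>fst p x\<bar> powr snd p \<partial>lborel) - (\<Sum>p\<leftarrow>ps. trunc_mass k p))"
  let ?A = "\<Sum>p\<leftarrow>ps. \<integral>x. \<bar>fst p x\<bar> powr snd p \<partial>lborel"
  have "(\<lambda>k. \<Sum>p\<leftarrow>qs. trunc_mass k p) \<longlonglongrightarrow> (\<Sum>p\<leftarrow>qs. \<integral>x. \<bar>fst p x\<bar> powr snd p \<partial>lborel)" if "\<forall>p\<in>set qs. admissible p" for qs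
    using that by (induction qs) (auto intro!: tendsto_add trunc_mass_limit(1))
  from this[OF ps] have "?d \<longlonglongrightarrow> 2 * ?c * (?A - ?A)" by (intro tendsto_mult tendsto_const tendsto_diff)
  then have "?d \<longlonglongrightarrow> 0" by simp
  then have 1: "\<forall>\<^sub>F k in sequentially. ?d k < e / 3" by (rule order_tendstoD) (use e in simp)
  have "?Lk \<longlonglongrightarrow> ?L" by (intro tendsto_intros integral_prod_trunc_tendsto assms)
  then have 2: "\<forall>\<^sub>F k in sequentially. dist (?Lk k) ?L < e / 3" by (rule tendstoD) (use e in simp)
  \<comment> \<open>The level is fixed before T: the truncation error per unit of T is below e/3 for
    all T > 0 simultaneously, and the limiting integrals are within e/3.\<close>
  obtain k where k: "?d k < e / 3" "dist (?Lk k) ?L < e / 3"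
    using eventually_conj[OF 1 2] by (auto simp: eventually_sequentially)
  obtain p qs where pq: "ps = p # qs" using s by (cases ps) auto
  have "list_all2 bounded_integrable (map (trunc k) qs) (map (\<lambda>p. (2 ^ k) powr (1 / snd p)) qs)"
    using ps pq trunc_bounded_integrable[of _ k k] by (auto simp: list_all2_map1 list_all2_map2 intro!: list.rel_refl_strong)
  from cyc_bounded_limit[OF trunc_bounded_integrable[of p k k] this]
  have "((\<lambda>T. cyc T (map (trunc k) ps) / T) \<longlongrightarrow> ?Lk k) at_top"
    using ps pq by (simp add: o_def)
  then have "\<forall>\<^sub>F T in at_top. dist (cyc T (map (trunc k) ps) / T) (?Lk k) < e / 3" by (rule tendstoD) (use e in simp)
  then show "\<forall>\<^sub>F T in at_top. dist (cyc T (map fst ps) / T) ?L < e"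
    using eventually_gt_at_top[of 0]
  proof eventually_elim
    case (elim T)
    have "\<bar>cyc T (map fst ps) / T - cyc T (map (trunc k) ps) / T\<bar> = \<bar>cyc T (map fst ps) - cyc T (map (trunc k) ps)\<bar> / T"
      using elim by (simp add: diff_divide_distrib[symmetric])
    also have "\<dots> \<le> ?d k"
      using cyc_trunc_diff_le[OF elim(2) ps s, of k] elim(2) by (simp add: pos_divide_le_eq mult_ac)
    finally show ?case using k elim(1) unfolding dist_real_def by linarith
  qed
qed

section \<open>Fractional Riesz--Bessel densities\<close>

lemma integrable_lborel_powr_nonneg:
  fixes a :: real
  assumes "(\<lambda>x. x powr a) integrable_on S" and [measurable]: "S \<in> sets borel"
  shows "integrable lborel (\<lambda>x. indicator S x * x powr a)"
proof -
  have "(\<lambda>x. x powr a) absolutely_integrable_on S"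
    by (rule nonnegative_absolutely_integrable_1[OF assms(1)]) simp
  then have "integrable lebesgue (\<lambda>x. indicator S x * x powr a)" by (simp add: set_integrable_def)
  then show ?thesis by (subst (asm) integrable_completion) auto
qed

text \<open>Near 0 the density behaves like |x|^(-2\<alpha>), at infinity like
  |x|^(-2(\<alpha>+\<beta>)); the two inequalities on the exponents are the integrability conditions
  at these ends.\<close>

lemma integrable_frbm_density:
  assumes c: "c > 0" and \<alpha>: "0 < \<alpha>" "\<alpha> < 1 / 2" and \<beta>: "\<beta> > 0" "\<alpha> + \<beta> > 1 / 2"
  shows "integrable lborel (frbm_density c \<alpha> \<beta>)"
proof -
  define G where "G x = indicator {0..1} x * x powr (- 2 * \<alpha>) + indicator {1..} x * x powr (- 2 * (\<alpha> + \<beta>))" for x :: real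
  define F where "F x = indicator {0<..} x * frbm_density c \<alpha> \<beta> x" for x :: real
  have "(\<lambda>x::real. x powr (- 2 * (\<alpha> + \<beta>))) integrable_on {1..}"
    using has_integral_powr_to_inf[of "- 2 * (\<alpha> + \<beta>)" 1] \<beta> by (auto simp: integrable_on_def)
  then have G: "integrable lborel G" unfolding G_def
    using \<alpha> by (intro Bochner_Integration.integrable_add integrable_lborel_powr_nonneg integrable_on_powr_from_0) auto
  have F: "integrable lborel F"
  proof (rule Bochner_Integration.integrable_bound[OF integrable_mult_right[OF G, of c]])
    show "F \<in> borel_measurable lborel" unfolding F_def frbm_density_def by measurable
    show "AE x in lborel. norm (F x) \<le> norm (c * G x)"
    proof (rule AE_I2)
      fix x :: real
      have "x powr (- 2 * \<alpha>) * (1 + x\<^sup>2) powr - \<beta> \<le> G x" if "x > 0"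
      proof (cases "x \<le> 1")
        case True
        have "(1 + x\<^sup>2) powr - \<beta> \<le> (1 + x\<^sup>2) powr 0" by (rule powr_mono) (use \<beta> in auto)
        then have "(1 + x\<^sup>2) powr - \<beta> \<le> 1" by (simp add: add_nonneg_eq_0_iff)
        then have "x powr (- 2 * \<alpha>) * (1 + x\<^sup>2) powr - \<beta> \<le> x powr (- 2 * \<alpha>) * 1" by (rule mult_left_mono) simp
        also have "\<dots> \<le> G x" using True that by (simp add: G_def)
        finally show ?thesis .
      next
        case False
        have "(1 + x\<^sup>2) powr - \<beta> \<le> (x\<^sup>2) powr - \<beta>"
          by (rule powr_mono2') (use \<beta> that in auto)
        also have "\<dots> = x powr (- 2 * \<beta>)"
          using that by (simp add: powr_powr flip: powr_numeral)
        finally have "x powr (- 2 * \<alpha>) * (1 + x\<^sup>2) powr - \<beta> \<le> x powr (- 2 * \<alpha>) * x powr (- 2 * \<beta>)"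
          by (rule mult_left_mono) simp
        also have "\<dots> = x powr (- 2 * (\<alpha> + \<beta>))" by (simp add: powr_add[symmetric] algebra_simps)
        also have "\<dots> = G x" using False by (simp add: G_def)
        finally show ?thesis .
      qed
      moreover have "G x \<ge> 0" by (simp add: G_def)
      ultimately show "norm (F x) \<le> norm (c * G x)"
        using c by (auto simp: F_def frbm_density_def abs_mult indicator_def mult.assoc)
    qed
  qed
  \<comment> \<open>This holds at 0 as well: \<open>F\<close> vanishes there, and so does the
    density, since a power with base 0 is 0 by convention.\<close>
  have "frbm_density c \<alpha> \<beta> = (\<lambda>x. F x + F (- x))"
    by (auto simp: F_def frbm_density_def indicator_def fun_eq_iff)
  moreover have "integrable lborel (\<lambda>x. F (- x))"
    using lborel_integrable_real_affine[OF F, of "-1" 0] by simp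
  ultimately show ?thesis using F by simp
qed

text \<open>The family is closed under positive powers, so integrability of a power of the density
  is again an instance of \<open>integrable_frbm_density\<close>.\<close>

lemma frbm_density_powr:
  assumes "c > 0"
  shows "\<bar>frbm_density c \<alpha> \<beta> x\<bar> powr r = frbm_density (c powr r) (\<alpha> * r) (\<beta> * r) x"
  using assms by (simp add: frbm_density_def abs_mult powr_mult powr_powr mult.assoc)

lemma integrable_powr_interpolate:
  fixes g :: "real \<Rightarrow> real"
  assumes g: "integrable lborel g" "integrable lborel (\<lambda>x. \<bar>g x\<bar> powr q)" and r: "1 \<le> r" "r \<le> q"
  shows "integrable lborel (\<lambda>x. \<bar>g x\<bar> powr r)"
proof (rule Bochner_Integration.integrable_bound[OF Bochner_Integration.integrable_add[OF integrable_abs[OF g(1)] g(2)]])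
  have [measurable]: "g \<in> borel_measurable borel" using g by auto
  show "(\<lambda>x. \<bar>g x\<bar> powr r) \<in> borel_measurable lborel" by measurable
  have "y powr r \<le> y + y powr q" if "y \<ge> 0" for y :: real
  proof (cases "y \<le> 1")
    case True
    then have "y powr r \<le> y powr 1" using r that by (intro powr_mono') auto
    then show ?thesis using that by (simp add: add_increasing2)
  next
    case False
    then have "y powr r \<le> y powr q" using r by (intro powr_mono) auto
    then show ?thesis using that by simp
  qed
  then show "AE x in lborel. norm (\<bar>g x\<bar> powr r) \<le> norm (\<bar>g x\<bar> + \<bar>g x\<bar> powr q)"
    by (intro AE_I2) (simp add: abs_of_nonneg)
qed

section \<open>Powers of the operator product as alternating chains\<close>

lemma toeplitz_chain_replicate:
  "(toeplitz_op T f \<circ> toeplitz_op T g) ^^ n = toeplitz_chain T (concat (replicate n [f, g]))"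
  by (induction n) (simp_all add: toeplitz_chain_def comp_assoc)

lemma op_trace_toeplitz_power:
  assumes T: "T > 0" and f: "integrable lborel f" and g: "integrable lborel g"
  shows "op_trace T ((toeplitz_op T f \<circ> toeplitz_op T g) ^^ Suc n) = of_real (cyc T (concat (replicate (Suc n) [f, g])))"
proof -
  \<comment> \<open>Brings the alternating list into the form with separate first and last symbols
    on which the trace formula is stated; every block ends in \<open>g\<close>.\<close>
  have "concat (replicate (Suc n) [f, g]) = f # butlast (g # concat (replicate n [f, g])) @ [g]"
    by (induction n) auto
  moreover have "\<forall>h\<in>set (butlast (g # concat (replicate n [f, g]))). integrable lborel h"
    using f g by (auto dest!: in_set_butlastD split: if_splits)
  ultimately show ?thesis unfolding toeplitz_chain_replicate
    using op_trace_toeplitz_chain[OF T f _ g] by metis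
qed

theorem theorem4p3:
  fixes \<nu> :: nat and c \<alpha> \<beta> p q :: real and g :: "real \<Rightarrow> real"
  assumes "\<nu> \<ge> 1"
    and "0 < c"
    and "integrable lborel g"
    and "\<And>x. g (- x) = g x"
    and "p \<ge> 1" and "q \<ge> 1"
    and "1 / p + 1 / q \<le> 1 / real \<nu>"
    and "integrable lborel (\<lambda>x. \<bar>g x\<bar> powr q)"
    and "0 < \<alpha>" and "\<alpha> < 1 / (2 * p)"
    and "\<alpha> + \<beta> > 1 / 2" and "\<beta> > 0"
  shows "((\<lambda>T. cmod (op_trace T
              ((toeplitz_op T (frbm_density c \<alpha> \<beta>) \<circ> toeplitz_op T g) ^^ \<nu>) / complex_of_real T
            - complex_of_real ((2 * pi) ^ (2 * \<nu> - 1) *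
                (\<integral>l. (frbm_density c \<alpha> \<beta> l * g l) ^ \<nu> \<partial>lborel))))
          \<longlongrightarrow> 0) at_top"
proof -
  let ?f = "frbm_density c \<alpha> \<beta>"
  \<comment> \<open>The common factor that shrinks \<open>p\<close> and \<open>q\<close> until the
    2\<nu> reciprocals sum to exactly 1; it is at most 1 by the hypothesis on 1/p + 1/q.\<close>
  define s where "s = real \<nu> * (1 / p + 1 / q)"
  define P Q where "P = p * s" and "Q = q * s"
  have s: "0 < s" "s \<le> 1" using assms(1,5,6,7) by (auto simp: s_def field_simps intro!: add_pos_pos)
  \<comment> \<open>In this form the exponents are visibly at least 1, because \<nu> is.\<close>
  have "P = real \<nu> * (1 + p / q)" "Q = real \<nu> * (1 + q / p)"
    using assms(5,6) by (auto simp: P_def Q_def s_def field_simps)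
  moreover have "1 * 1 \<le> real \<nu> * (1 + p / q)" "1 * 1 \<le> real \<nu> * (1 + q / p)"
    using assms(1,5,6) by (intro mult_mono; simp)+
  ultimately have PQ1: "1 \<le> P" "1 \<le> Q" by auto
  have PQ2: "P \<le> p" "Q \<le> q" using s assms(5,6) by (auto simp: P_def Q_def)
  have PQ: "real \<nu> * (1 / P + 1 / Q) = 1"
  proof -
    have "1 / P + 1 / Q = (1 / p + 1 / q) / s" by (simp add: P_def Q_def add_divide_distrib)
    then have "real \<nu> * (1 / P + 1 / Q) = s / s" by (simp only: times_divide_eq_right s_def)
    then show ?thesis using s(1) by simp
  qed
  \<comment> \<open>Integrability at 0 of the P-th power of the density; the condition at infinity
    follows from P >= 1.\<close>
  have \<alpha>P: "\<alpha> * P < 1 / 2"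
  proof -
    have "\<alpha> * P \<le> \<alpha> * p" using PQ2 assms(9) by simp
    also have "\<dots> < 1 / 2" using assms(5,10) by (simp add: field_simps)
    finally show ?thesis .
  qed
  have "\<alpha> * 1 \<le> \<alpha> * P" using PQ1 assms(9) by (intro mult_left_mono) auto
  then have "\<alpha> < 1 / 2" using \<alpha>P by linarith
  then have f: "integrable lborel ?f" using assms by (intro integrable_frbm_density)
  have "(\<alpha> + \<beta>) * 1 \<le> (\<alpha> + \<beta>) * P" using PQ1 assms by (intro mult_left_mono) auto
  then have "integrable lborel (\<lambda>x. \<bar>?f x\<bar> powr P)"
    unfolding frbm_density_powr[OF assms(2)] using \<alpha>P PQ1 assms
    by (intro integrable_frbm_density) (auto simp: algebra_simps)
  then have adf: "admissible (?f, P)" using f PQ1 by (simp add: admissible_def)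
  \<comment> \<open>Since 1 \<le> Q \<le> q, the moment of order Q lies between the two that are
    given.\<close>
  have adg: "admissible (g, Q)"
    using assms(3) PQ1 integrable_powr_interpolate[OF assms(3,8) PQ1(2) PQ2(2)] by (simp add: admissible_def)
  define ps where "ps = concat (replicate \<nu> [(?f, P), (g, Q)])"
  have "sum_list (map (\<lambda>p. 1 / snd p) (concat (replicate n [(?f, P), (g, Q)]))) = real n * (1 / P + 1 / Q)" for n
    by (induction n) (auto simp: algebra_simps)
  then have sum: "(\<Sum>p\<leftarrow>ps. 1 / snd p) = 1" using PQ by (simp add: ps_def)
  have ad: "\<forall>p\<in>set ps. admissible p" using adf adg by (auto simp: ps_def split: if_splits)
  have fst: "map fst ps = concat (replicate \<nu> [?f, g])"
    by (simp add: ps_def map_concat)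
  have "length (concat (replicate n [(?f, P), (g, Q)])) = 2 * n" for n by (induction n) auto
  then have len: "length ps = 2 * \<nu>" by (simp add: ps_def)
  have "(\<Prod>p\<leftarrow>concat (replicate n [(?f, P), (g, Q)]). fst p x) = (?f x * g x) ^ n" for n x
    by (induction n) auto
  then have prod: "(\<Prod>p\<leftarrow>ps. fst p x) = (?f x * g x) ^ \<nu>" for x by (simp add: ps_def)
  let ?L = "(2 * pi) ^ (2 * \<nu> - 1) * (\<integral>l. (?f l * g l) ^ \<nu> \<partial>lborel)"
  have "((\<lambda>T. cyc T (concat (replicate \<nu> [?f, g])) / T) \<longlongrightarrow> ?L) at_top"
    using cyc_limit[OF ad sum] unfolding len prod fst .
  then have "((\<lambda>T. \<bar>cyc T (concat (replicate \<nu> [?f, g])) / T - ?L\<bar>) \<longlongrightarrow> 0) at_top"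
    using LIM_zero tendsto_rabs_zero by blast
  moreover have "\<forall>\<^sub>F T in at_top. \<bar>cyc T (concat (replicate \<nu> [?f, g])) / T - ?L\<bar> =
    cmod (op_trace T ((toeplitz_op T ?f \<circ> toeplitz_op T g) ^^ \<nu>) / complex_of_real T - complex_of_real ?L)"
    using eventually_gt_at_top[of 0]
  proof eventually_elim
    case (elim T)
    have "op_trace T ((toeplitz_op T ?f \<circ> toeplitz_op T g) ^^ \<nu>) = of_real (cyc T (concat (replicate \<nu> [?f, g])))"
      using op_trace_toeplitz_power[OF elim f assms(3), of "\<nu> - 1"] assms(1) by simp
    then have "cmod (op_trace T ((toeplitz_op T ?f \<circ> toeplitz_op T g) ^^ \<nu>) / complex_of_real T - complex_of_real ?L) =
      cmod (complex_of_real (cyc T (concat (replicate \<nu> [?f, g])) / T - ?L))"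
      by (simp only: of_real_diff of_real_divide)
    then show ?case by (simp only: norm_of_real)
  qed
  ultimately show ?thesis by (rule Lim_transform_eventually)
qed

end
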